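(* Let $\Phi_2(z)=\sum_{n\ge0}z^{4^n/3}$, and let $\alpha$ be a positive integer. Then the generating function $S_{\mathfrak H(5)}(z)=\sum_{n\ge0}s_{n+1}(\mathfrak H(5))\,z^n$, reduced modulo $2^{4^\alpha}$, can be expressed as a polynomial in $\Phi_2(z)$ of degree at most $4^{\alpha+1}-1$ with coefficients that are Laurent polynomials in $z^{1/3}$ over the integers.
   Context: $\mathfrak H(5)=C_2*C_5$ is the Hecke group (free product of cyclic groups of orders $2$ and $5$). For a finitely generated group $\Gamma$, $s_n(\Gamma)$ denotes the number of subgroups of index $n$ in $\Gamma$. Series are regarded as formal Laurent series in $z^{1/3}$ with integer coefficients; "reduced modulo $M$, can be expressed as" means that coefficients of equal powers agree modulo $M$. *)

theory Defs
  imports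
    "HOL-Algebra.Elementary_Groups"
    "HOL-Algebra.Coset"
    "HOL-Computational_Algebra.Formal_Laurent_Series"
    "HOL-Number_Theory.Cong"
begin

section \<open>Free products of groups\<close>

text \<open>
  The free product of \<open>G\<close> and \<open>H\<close> is the monoid of words over the disjoint union of the two
  carriers, modulo the smallest monoid congruence that identifies the letters \<open>\<one>\<close> with the empty
  word and multiplies adjacent letters coming from the same factor.
\<close>

inductive free_prod_cong ::
    "('a, 'c) monoid_scheme \<Rightarrow> ('b, 'd) monoid_scheme \<Rightarrow> ('a + 'b) list \<Rightarrow> ('a + 'b) list \<Rightarrow> bool"
  for G (structure) and H (structure) where
  refl: "u \<in> lists (carrier G <+> carrier H) \<Longrightarrow> free_prod_cong G H u u"
| sym: "free_prod_cong G H u v \<Longrightarrow> free_prod_cong G H v u"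
| trans: "free_prod_cong G H u v \<Longrightarrow> free_prod_cong G H v w \<Longrightarrow> free_prod_cong G H u w"
| append: "free_prod_cong G H u u' \<Longrightarrow> free_prod_cong G H v v' \<Longrightarrow>
    free_prod_cong G H (u @ v) (u' @ v')"
| one_left: "free_prod_cong G H [Inl \<one>\<^bsub>G\<^esub>] []"
| one_right: "free_prod_cong G H [Inr \<one>\<^bsub>H\<^esub>] []"
| mult_left: "x \<in> carrier G \<Longrightarrow> y \<in> carrier G \<Longrightarrow>
    free_prod_cong G H [Inl x, Inl y] [Inl (x \<otimes>\<^bsub>G\<^esub> y)]"
| mult_right: "x \<in> carrier H \<Longrightarrow> y \<in> carrier H \<Longrightarrow>
    free_prod_cong G H [Inr x, Inr y] [Inr (x \<otimes>\<^bsub>H\<^esub> y)]"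

definition free_product ::
    "('a, 'c) monoid_scheme \<Rightarrow> ('b, 'd) monoid_scheme \<Rightarrow> ('a + 'b) list set monoid" where
  "free_product G H =
     \<lparr>carrier = lists (carrier G <+> carrier H) // {(u, v). free_prod_cong G H u v},
      monoid.mult = (\<lambda>A B. {w. \<exists>u\<in>A. \<exists>v\<in>B. free_prod_cong G H (u @ v) w}),
      one = {w. free_prod_cong G H [] w}\<rparr>"

lemma free_prod_cong_in_lists:
  assumes "monoid G" "monoid H" "free_prod_cong G H u v"
  shows "u \<in> lists (carrier G <+> carrier H)" "v \<in> lists (carrier G <+> carrier H)"
proof -
  interpret G: monoid G by fact
  interpret H: monoid H by fact
  have "u \<in> lists (carrier G <+> carrier H) \<and> v \<in> lists (carrier G <+> carrier H)"
    using assms(3) by induction auto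
  then show "u \<in> lists (carrier G <+> carrier H)" "v \<in> lists (carrier G <+> carrier H)"
    by auto
qed

lemma carrier_free_product_iff:
  "A \<in> carrier (free_product G H) \<longleftrightarrow>
     (\<exists>u \<in> lists (carrier G <+> carrier H). A = {w. free_prod_cong G H u w})"
  by (auto simp: free_product_def quotient_def)

lemma free_product_class_eq:
  assumes "free_prod_cong G H u v"
  shows "{w. free_prod_cong G H u w} = {w. free_prod_cong G H v w}"
  using assms by (blast intro: free_prod_cong.sym free_prod_cong.trans)

lemma free_product_mult_class:
  assumes "u \<in> lists (carrier G <+> carrier H)" "v \<in> lists (carrier G <+> carrier H)"
  shows "{w. free_prod_cong G H u w} \<otimes>\<^bsub>free_product G H\<^esub> {w. free_prod_cong G H v w} =
         {w. free_prod_cong G H (u @ v) w}"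
  using assms unfolding free_product_def
  by simp (blast intro: free_prod_cong.intros)

lemma free_prod_cong_inverse:
  assumes "group G" "group H" "u \<in> lists (carrier G <+> carrier H)"
  shows "\<exists>v \<in> lists (carrier G <+> carrier H). free_prod_cong G H (v @ u) []"
  using assms(3)
proof (induction u)
  case Nil
  then show ?case
    by (auto intro!: bexI[of _ "[]"] free_prod_cong.refl)
next
  interpret G: group G by fact
  interpret H: group H by fact
  case (Cons a u)
  then obtain v where v: "v \<in> lists (carrier G <+> carrier H)" "free_prod_cong G H (v @ u) []"
    by auto
  have u: "u \<in> lists (carrier G <+> carrier H)" and a: "a \<in> carrier G <+> carrier H"
    using Cons by auto
  obtain b where b: "b \<in> carrier G <+> carrier H" "free_prod_cong G H [b, a] []"
  proof (cases a)
    case (Inl x)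
    then have x: "x \<in> carrier G" using a by auto
    then have "free_prod_cong G H [Inl (inv\<^bsub>G\<^esub> x), Inl x] []"
      using free_prod_cong.mult_left[of "inv\<^bsub>G\<^esub> x" G x H] free_prod_cong.one_left[of G H]
      by (auto intro: free_prod_cong.trans)
    then show ?thesis using that[of "Inl (inv\<^bsub>G\<^esub> x)"] Inl x by auto
  next
    case (Inr x)
    then have x: "x \<in> carrier H" using a by auto
    then have "free_prod_cong G H [Inr (inv\<^bsub>H\<^esub> x), Inr x] []"
      using free_prod_cong.mult_right[of "inv\<^bsub>H\<^esub> x" H x G] free_prod_cong.one_right[of G H]
      by (auto intro: free_prod_cong.trans)
    then show ?thesis using that[of "Inr (inv\<^bsub>H\<^esub> x)"] Inr x by auto
  qed
  have "free_prod_cong G H (v @ ([b, a] @ u)) (v @ ([] @ u))"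
    using u v b by (intro free_prod_cong.append free_prod_cong.refl) auto
  then have "free_prod_cong G H ((v @ [b]) @ (a # u)) []"
    using v by (auto intro: free_prod_cong.trans)
  then show ?case
    using v b by (intro bexI[of _ "v @ [b]"]) auto
qed

lemma group_free_product:
  assumes "group G" "group H"
  shows "group (free_product G H)"
proof (rule groupI)
  let ?F = "free_product G H"
  let ?W = "lists (carrier G <+> carrier H)"
  have one: "\<one>\<^bsub>?F\<^esub> = {w. free_prod_cong G H [] w}"
    by (simp add: free_product_def)
  show "\<one>\<^bsub>?F\<^esub> \<in> carrier ?F"
    unfolding one carrier_free_product_iff by (intro bexI[of _ "[]"]) auto
  fix A assume A: "A \<in> carrier ?F"
  then obtain u where u: "u \<in> ?W" "A = {w. free_prod_cong G H u w}"
    unfolding carrier_free_product_iff by blast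
  show "\<one>\<^bsub>?F\<^esub> \<otimes>\<^bsub>?F\<^esub> A = A"
    using free_product_mult_class[of "[]" G H u] u one by simp
  obtain v where v: "v \<in> ?W" "free_prod_cong G H (v @ u) []"
    using free_prod_cong_inverse[OF assms u(1)] by blast
  show "\<exists>B\<in>carrier ?F. B \<otimes>\<^bsub>?F\<^esub> A = \<one>\<^bsub>?F\<^esub>"
  proof (rule bexI)
    show "{w. free_prod_cong G H v w} \<otimes>\<^bsub>?F\<^esub> A = \<one>\<^bsub>?F\<^esub>"
      using free_product_mult_class[OF v(1) u(1)] free_product_class_eq[OF v(2)] u one by simp
    show "{w. free_prod_cong G H v w} \<in> carrier ?F"
      using v unfolding carrier_free_product_iff by blast
  qed
  fix B assume B: "B \<in> carrier ?F"
  then obtain v where v: "v \<in> ?W" "B = {w. free_prod_cong G H v w}"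
    unfolding carrier_free_product_iff by blast
  have uv: "u @ v \<in> ?W" using u v by auto
  show "A \<otimes>\<^bsub>?F\<^esub> B \<in> carrier ?F"
    using free_product_mult_class[OF u(1) v(1)] u v uv unfolding carrier_free_product_iff by blast
  fix C assume C: "C \<in> carrier ?F"
  then obtain x where x: "x \<in> ?W" "C = {w. free_prod_cong G H x w}"
    unfolding carrier_free_product_iff by blast
  have vx: "v @ x \<in> ?W" using x v by auto
  show "A \<otimes>\<^bsub>?F\<^esub> B \<otimes>\<^bsub>?F\<^esub> C = A \<otimes>\<^bsub>?F\<^esub> (B \<otimes>\<^bsub>?F\<^esub> C)"
    using u v x uv vx by (simp add: free_product_mult_class)
qed

text \<open>The existence part of the universal property of the free product.\<close>

lemma free_product_universal:
  assumes G: "group G" and H: "group H" and K: "group K"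
    and f: "f \<in> hom G K" and g: "g \<in> hom H K"
  shows "\<exists>h \<in> hom (free_product G H) K.
           (\<forall>x\<in>carrier G. h {w. free_prod_cong G H [Inl x] w} = f x) \<and>
           (\<forall>y\<in>carrier H. h {w. free_prod_cong G H [Inr y] w} = g y)"
proof -
  interpret K: group K by fact
  let ?F = "free_product G H"
  let ?W = "lists (carrier G <+> carrier H)"
  let ?cl = "\<lambda>u. {w. free_prod_cong G H u w}"
  define e where "e = (\<lambda>u. foldr (\<lambda>a k. case_sum f g a \<otimes>\<^bsub>K\<^esub> k) u \<one>\<^bsub>K\<^esub>)"
  define h where "h = (\<lambda>A. e (SOME u. u \<in> A))"
  have letter: "case_sum f g a \<in> carrier K" if "a \<in> carrier G <+> carrier H" for a
    using that f g by (auto simp: hom_def)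
  have e_closed: "e u \<in> carrier K" if "u \<in> ?W" for u
    using that by (induction u) (auto simp: e_def letter simp del: Plus_def)
  have e_append: "e (u @ v) = e u \<otimes>\<^bsub>K\<^esub> e v" if "u \<in> ?W" "v \<in> ?W" for u v
    using that
  proof (induction u)
    case Nil
    then show ?case using e_closed[of v] by (simp add: e_def)
  next
    case (Cons a u)
    have [simp]: "e (a # w) = case_sum f g a \<otimes>\<^bsub>K\<^esub> e w" for w by (simp add: e_def)
    show ?case using Cons e_closed[of u] e_closed[of v] letter[of a]
      by (auto simp: K.m_assoc)
  qed
  have e_cong: "e u = e v" if "free_prod_cong G H u v" for u v
    using that
  proof induction
    case (append u u' v v')
    then show ?case
      using free_prod_cong_in_lists[OF group.is_monoid[OF G] group.is_monoid[OF H]]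
      by (metis e_append)
  next
    case one_left
    show ?case using hom_one[OF f G K] by (simp add: e_def)
  next
    case one_right
    show ?case using hom_one[OF g H K] by (simp add: e_def)
  next
    case (mult_left x y)
    then show ?case using f by (simp add: e_def hom_def Pi_iff)
  next
    case (mult_right x y)
    then show ?case using g by (simp add: e_def hom_def Pi_iff)
  qed auto
  have h_class: "h (?cl u) = e u" if "u \<in> ?W" for u
  proof -
    have "(SOME w. w \<in> ?cl u) \<in> ?cl u"
      by (rule someI[of _ u]) (simp add: free_prod_cong.refl that)
    then show ?thesis unfolding h_def using e_cong by fastforce
  qed
  have "h \<in> hom ?F K"
  proof (rule homI)
    fix A assume "A \<in> carrier ?F"
    then obtain u where u: "u \<in> ?W" "A = ?cl u"
      unfolding carrier_free_product_iff by blast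
    then show "h A \<in> carrier K" using h_class e_closed by simp
    fix B assume "B \<in> carrier ?F"
    then obtain v where v: "v \<in> ?W" "B = ?cl v"
      unfolding carrier_free_product_iff by blast
    have "u @ v \<in> ?W" using u v by auto
    then show "h (A \<otimes>\<^bsub>?F\<^esub> B) = h A \<otimes>\<^bsub>K\<^esub> h B"
      using u v by (simp add: free_product_mult_class h_class e_append)
  qed
  moreover have "h (?cl [Inl x]) = f x" if "x \<in> carrier G" for x
    using h_class[of "[Inl x]"] that f by (simp add: e_def hom_def Pi_iff InlI InrI)
  moreover have "h (?cl [Inr y]) = g y" if "y \<in> carrier H" for y
    using h_class[of "[Inr y]"] that g by (simp add: e_def hom_def Pi_iff InlI InrI)
  ultimately show ?thesis by blast
qed

section \<open>Hecke groups and subgroup numbers\<close>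

definition hecke_group :: "nat \<Rightarrow> (int + int) list set monoid" where
  "hecke_group q = free_product (integer_mod_group 2) (integer_mod_group q)"

text \<open>
  Only meaningful for finitely generated groups and \<open>n > 0\<close>: \<open>card\<close> is \<open>0\<close> on infinite sets, so
  \<open>n = 0\<close> would pick out the subgroups of infinite index.
\<close>

definition subgroup_number :: "('a, 'b) monoid_scheme \<Rightarrow> nat \<Rightarrow> nat" where
  "subgroup_number G n = card {H. subgroup H G \<and> card (rcosets\<^bsub>G\<^esub> H) = n}"

section \<open>Formal Laurent series in the cube root of the variable\<close>

text \<open>
  Formal Laurent series in \<open>z\<^bsup>1/3\<^esup>\<close> are elements of \<^typ>\<open>int fls\<close> whose indeterminate
  \<^const>\<open>fls_X\<close> stands for \<open>z\<^bsup>1/3\<^esup>\<close>; the coefficient of \<open>z\<^bsup>k/3\<^esup>\<close> is the one with index \<open>k\<close>.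
  A series in \<open>z\<close> is embedded by substituting \<open>z = fls_X ^ 3\<close>.
\<close>

definition subgroup_gf :: "('a, 'b) monoid_scheme \<Rightarrow> int fls" where
  "subgroup_gf G =
     fls_compose_power (fps_to_fls (Abs_fps (\<lambda>n. int (subgroup_number G (n + 1))))) 3"

text \<open>
  The summand \<open>z\<^bsup>4^n/3\<^esup>\<close> is \<open>fls_X ^ 4 ^ n\<close>; these exponents are distinct, so every coefficient of
  the sum over \<open>n\<close> is \<open>0\<close> or \<open>1\<close>.
\<close>

definition Phi2 :: "int fls" where
  "Phi2 = fps_to_fls (Abs_fps (\<lambda>k. if \<exists>n::nat. k = 4 ^ n then 1 else 0))"

definition laurent_polynomial :: "'a::zero fls \<Rightarrow> bool" where
  "laurent_polynomial f \<longleftrightarrow> finite {k. fls_nth f k \<noteq> 0}"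

definition fls_cong :: "int fls \<Rightarrow> int fls \<Rightarrow> int \<Rightarrow> bool" where
  "fls_cong f g M \<longleftrightarrow> (\<forall>k. [fls_nth f k = fls_nth g k] (mod M))"

end

(*
  Let a(n) and b(n) count the actions of C_2 and C_5 on an n-set, so that a(n) b(n) counts the
  actions of the Hecke group. Decomposing an action along the orbit of a base point gives
  a(n + 1) = a(n) + n a(n - 1), the analogous recursion for b, and z F' = z S F, where S is the
  generating function of the subgroup numbers and F the one of a(n) b(n) / n!. The moments
  m_j = sum_n a(n + j) b(n) z^n / n! satisfy
    m_(j+1) = (1 + z) m_j + j m_(j-1) + z^5 m_(j+4),
  and hence so do the quotients u_j = m_j / F. Since u_0 = 1 and z^5 contracts, the u_j are
  integral power series, uniquely determined by the system, and z S = u_2 - u_1 - 1.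

  Modulo 2^m the system is 2^m-periodic in j, so u_(j+q) = u_q u_j for all multiples q of 2^m.
  Moreover x_i = u_(2i) satisfies z^10 x_(i+4) = x_(i+1) + z^2 x_i + 2 (...). For m = 1 this gives
  the algebraic equation that identifies u_2 with z^(-10/3) (Phi - z^(1/3) - z^(4/3)) modulo 2.
  For the step from m to m + 1, work modulo the ring N of series congruent modulo 2^(m+1) to
  polynomials in Phi; it contains 2 u_j by the induction hypothesis. Freshman's dream and iteration
  turn the relation into linear relations of x_Q with x_0 and x_(4Q), and of x_(i+1) with x_i and
  x_(i+Q), where Q = 4^m. As x_(4Q) = x_(2Q)^2 is a square of a series known modulo 2^m, it lies in
  N, hence so do x_Q, all x_(i+Q) = x_Q x_i, and all x_i.

  Finally (Phi^4 - Phi + z^(1/3))^K is monic of degree 4K and divisible by 2^K, which bounds the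
  degree.
*)
theory Submission
  imports Defs
begin

unbundle fps_syntax
unbundle Formal_Power_Series.fps_syntax

section \<open>Counting group actions by subgroups\<close>

text \<open>Right actions fit the right cosets \<open>H #> g\<close>, which \<open>G\<close>
  permutes by right translation. Extensionality makes an action a unique function, so that
  cardinalities of these sets count actions.\<close>

definition right_actions :: "('g, 'm) monoid_scheme \<Rightarrow> 'a set \<Rightarrow> ('a \<times> 'g \<Rightarrow> 'a) set" where
  "right_actions G S = {\<phi> \<in> S \<times> carrier G \<rightarrow>\<^sub>E S. (\<forall>s\<in>S. \<phi> (s, \<one>\<^bsub>G\<^esub>) = s) \<and>
     (\<forall>s\<in>S. \<forall>g\<in>carrier G. \<forall>h\<in>carrier G. \<phi> (s, g \<otimes>\<^bsub>G\<^esub> h) = \<phi> (\<phi> (s, g), h))}"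

lemma right_actionsD:
  assumes "\<phi> \<in> right_actions G S"
  shows "\<And>s g. s \<in> S \<Longrightarrow> g \<in> carrier G \<Longrightarrow> \<phi> (s, g) \<in> S"
    and "\<And>s. s \<in> S \<Longrightarrow> \<phi> (s, \<one>\<^bsub>G\<^esub>) = s"
    and "\<And>s g h. s \<in> S \<Longrightarrow> g \<in> carrier G \<Longrightarrow> h \<in> carrier G \<Longrightarrow> \<phi> (s, g \<otimes>\<^bsub>G\<^esub> h) = \<phi> (\<phi> (s, g), h)"
    and "\<phi> \<in> extensional (S \<times> carrier G)"
  using assms by (auto simp: right_actions_def PiE_iff)

lemma right_actionsI:
  assumes "\<And>s g. s \<in> S \<Longrightarrow> g \<in> carrier G \<Longrightarrow> \<phi> (s, g) \<in> S"
    and "\<And>s. s \<in> S \<Longrightarrow> \<phi> (s, \<one>\<^bsub>G\<^esub>) = s"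
    and "\<And>s g h. s \<in> S \<Longrightarrow> g \<in> carrier G \<Longrightarrow> h \<in> carrier G \<Longrightarrow> \<phi> (s, g \<otimes>\<^bsub>G\<^esub> h) = \<phi> (\<phi> (s, g), h)"
    and "\<phi> \<in> extensional (S \<times> carrier G)"
  shows "\<phi> \<in> right_actions G S"
  using assms by (auto simp: right_actions_def PiE_iff)

lemma right_actions_eqI:
  assumes "\<phi> \<in> right_actions G S" "\<psi> \<in> right_actions G S"
    and "\<And>s g. s \<in> S \<Longrightarrow> g \<in> carrier G \<Longrightarrow> \<phi> (s, g) = \<psi> (s, g)"
  shows "\<phi> = \<psi>"
  using assms by (intro extensionalityI[OF right_actionsD(4) right_actionsD(4)]) auto

lemma finite_right_actions:
  assumes "finite (carrier G)" "finite S"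
  shows "finite (right_actions G S)"
  by (rule finite_subset[of _ "S \<times> carrier G \<rightarrow>\<^sub>E S"])
     (use assms in \<open>auto simp: right_actions_def intro: finite_PiE\<close>)

lemma right_actions_empty: "right_actions G {} = {\<lambda>_. undefined}"
  by (auto simp: right_actions_def)

section \<open>Decomposition of an action along the orbit of a base point\<close>

context group
begin

text \<open>Labellings of a prospective orbit of \<open>x\<close> by the cosets of its prospective
  stabilizer \<open>H\<close>; the trivial coset labels \<open>x\<close> itself.\<close>

definition based_injections :: "'c \<Rightarrow> 'c set \<Rightarrow> 'a set \<Rightarrow> ('a set \<Rightarrow> 'c) set" where
  "based_injections x S H = {\<beta> \<in> rcosets H \<rightarrow>\<^sub>E S. inj_on \<beta> (rcosets H) \<and> \<beta> H = x}"

definition actions_along :: "'c set \<Rightarrow> 'a set \<Rightarrow> ('a set \<Rightarrow> 'c) \<Rightarrow> ('c \<times> 'a \<Rightarrow> 'c) set" where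
  "actions_along S H \<beta> = {\<phi> \<in> right_actions G S. \<forall>g\<in>carrier G. \<phi> (\<beta> H, g) = \<beta> (H #> g)}"

lemma rcoset_eq_iff:
  assumes H: "subgroup H G" and g: "g \<in> carrier G" and h: "h \<in> carrier G"
  shows "H #> g = H #> h \<longleftrightarrow> g \<otimes> inv h \<in> H"
proof -
  interpret H: subgroup H G by fact
  have "H #> g = H #> h \<longleftrightarrow> g \<in> H #> h"
    using repr_independence[OF _ h H] rcos_self[OF g H] by metis
  also have "\<dots> \<longleftrightarrow> g \<otimes> inv h \<in> H"
    using H.rcos_module[OF is_group h g] by simp
  finally show ?thesis .
qed

lemma subgroup_in_rcosets: "subgroup H G \<Longrightarrow> H \<in> rcosets H"
  by (metis coset_join2 one_closed rcosetsI subgroup.one_closed subgroup.subset)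

text \<open>Orbit-stabilizer theorem: take \<open>H\<close> to be the stabilizer of \<open>x\<close>
  and let \<open>\<beta>\<close> send the coset of \<open>g\<close> to
  \<open>\<phi> (x, g)\<close>.\<close>

lemma ex_actions_along:
  assumes \<phi>: "\<phi> \<in> right_actions G S" and x: "x \<in> S"
  shows "\<exists>H \<beta>. subgroup H G \<and> \<beta> \<in> based_injections x S H \<and> \<phi> \<in> actions_along S H \<beta>"
proof -
  note a = right_actionsD[OF \<phi>]
  define H where "H = {g \<in> carrier G. \<phi> (x, g) = x}"
  have H: "subgroup H G"
  proof (rule subgroupI)
    show "H \<subseteq> carrier G" by (auto simp: H_def)
    show "H \<noteq> {}" using a(2)[OF x] by (auto simp: H_def)
  next
    fix g assume g: "g \<in> H"
    then have "\<phi> (x, inv g) = \<phi> (\<phi> (x, g), inv g)" by (simp add: H_def)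
    also have "\<dots> = \<phi> (x, g \<otimes> inv g)" using a(3)[OF x, of g "inv g"] g by (simp add: H_def)
    finally show "inv g \<in> H" using g x by (simp add: H_def a(2))
  next
    fix g h assume "g \<in> H" "h \<in> H"
    then show "g \<otimes> h \<in> H" using x by (simp add: H_def a(3))
  qed
  have eq: "\<phi> (x, g) = \<phi> (x, h) \<longleftrightarrow> H #> g = H #> h" if g: "g \<in> carrier G" and h: "h \<in> carrier G" for g h
  proof -
    have "H #> g = H #> h \<longleftrightarrow> \<phi> (x, g \<otimes> inv h) = x"
      using rcoset_eq_iff[OF H g h] g h by (simp add: H_def)
    also have "\<dots> \<longleftrightarrow> \<phi> (x, g) = \<phi> (x, h)"
    proof
      assume "\<phi> (x, g \<otimes> inv h) = x"
      then have "\<phi> (x, h) = \<phi> (x, g \<otimes> inv h \<otimes> h)" using g h x by (simp add: a(3))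
      then show "\<phi> (x, g) = \<phi> (x, h)" using g h by (simp add: m_assoc)
    next
      assume "\<phi> (x, g) = \<phi> (x, h)"
      then have "\<phi> (x, g \<otimes> inv h) = \<phi> (x, h \<otimes> inv h)" 
        using a(3)[OF x, of g "inv h"] a(3)[OF x, of h "inv h"] g h by simp
      then show "\<phi> (x, g \<otimes> inv h) = x" using h x by (simp add: a(2))
    qed
    finally show ?thesis by simp
  qed
  \<comment> \<open>By \<open>eq\<close>, cosets correspond to points of the orbit, so the chosen
    representative does not matter.\<close>
  define \<beta> where "\<beta> = restrict (\<lambda>C. \<phi> (x, SOME g. g \<in> carrier G \<and> H #> g = C)) (rcosets H)"
  have \<beta>: "\<beta> (H #> g) = \<phi> (x, g)" if g: "g \<in> carrier G" for g
  proof -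
    let ?g = "SOME h. h \<in> carrier G \<and> H #> h = H #> g"
    have "?g \<in> carrier G \<and> H #> ?g = H #> g" by (rule someI[of _ g]) (simp add: g)
    then have "\<phi> (x, ?g) = \<phi> (x, g)" using eq[of ?g g] g by blast
    then show ?thesis using rcosetsI[OF subgroup.subset[OF H] g] by (simp add: \<beta>_def)
  qed
  have \<beta>H: "\<beta> H = x"
    using \<beta>[OF one_closed] a(2)[OF x] coset_mult_one[OF subgroup.subset[OF H]] by simp
  have "\<beta> \<in> based_injections x S H"
  proof -
    have "\<beta> \<in> rcosets H \<rightarrow>\<^sub>E S"
    proof (rule PiE_I)
      fix C assume "C \<in> rcosets H"
      then obtain g where "g \<in> carrier G" "C = H #> g" by (auto simp: RCOSETS_def)
      then show "\<beta> C \<in> S" using \<beta> a(1)[OF x] by simp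
    qed (simp add: \<beta>_def)
    moreover have "inj_on \<beta> (rcosets H)"
      by (rule inj_onI) (auto simp: RCOSETS_def \<beta> eq)
    ultimately show ?thesis using \<beta>H by (simp add: based_injections_def)
  qed
  moreover have "\<phi> \<in> actions_along S H \<beta>"
    using \<phi> \<beta> \<beta>H by (simp add: actions_along_def)
  ultimately show ?thesis using H by blast
qed

text \<open>The action determines the pair: \<open>H\<close> is recovered as the stabilizer of
  \<open>x\<close>, and then \<open>\<beta>\<close> as the orbit map. Together with
  \<open>ex_actions_along\<close>, the sets \<open>actions_along\<close> are disjoint pieces
  covering all actions.\<close>

lemma actions_along_disjoint:
  assumes "subgroup H G" "\<beta> \<in> based_injections x S H" "subgroup H' G" "\<beta>' \<in> based_injections x S H'"
    and \<phi>: "\<phi> \<in> actions_along S H \<beta>" "\<phi> \<in> actions_along S H' \<beta>'"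
  shows "H = H'" "\<beta> = \<beta>'"
proof -
  have *: "H = {g \<in> carrier G. \<phi> (x, g) = x}"
    if H: "subgroup H G" and \<beta>: "\<beta> \<in> based_injections x S H" and \<phi>: "\<phi> \<in> actions_along S H \<beta>" for H \<beta>
  proof -
    have "\<phi> (x, g) = x \<longleftrightarrow> g \<in> H" if g: "g \<in> carrier G" for g
    proof -
      have "\<phi> (x, g) = x \<longleftrightarrow> \<beta> (H #> g) = \<beta> H"
        using \<phi> \<beta> g by (auto simp: actions_along_def based_injections_def)
      also have "\<dots> \<longleftrightarrow> H #> g = H"
        using \<beta> inj_on_eq_iff[of \<beta> "rcosets H" "H #> g" H] rcosetsI[OF subgroup.subset[OF H] g]
          subgroup_in_rcosets[OF H]
        by (auto simp: based_injections_def)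
      also have "\<dots> \<longleftrightarrow> g \<in> H"
        using g H coset_join1 coset_join2 by metis
      finally show ?thesis .
    qed
    then show ?thesis using subgroup.subset[OF H] by blast
  qed
  show "H = H'" using *[OF assms(1,2) \<phi>(1)] *[OF assms(3,4) \<phi>(2)] by simp
  then have "\<beta> C = \<beta>' C" if "C \<in> rcosets H" for C
    using that \<phi> assms(2,4) by (auto simp: RCOSETS_def actions_along_def based_injections_def)
  then show "\<beta> = \<beta>'"
    using assms(2,4) \<open>H = H'\<close> unfolding based_injections_def
    by (intro extensionalityI[of _ "rcosets H"]) (auto simp: PiE_iff)
qed

text \<open>
  Along \<open>\<beta>\<close> the action is the translation action on cosets; the remaining freedom is an arbitrary
  action on the complement of the orbit.
\<close>

lemma bij_betw_actions_along:
  assumes H: "subgroup H G" and \<beta>: "\<beta> \<in> based_injections x S H"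
  shows "bij_betw (\<lambda>\<phi>. restrict \<phi> ((S - \<beta> ` (rcosets H)) \<times> carrier G))
           (actions_along S H \<beta>) (right_actions G (S - \<beta> ` (rcosets H)))"
proof -
  define O' where "O' = \<beta> ` (rcosets H)"
  let ?R = "S - O'"
  have inj: "inj_on \<beta> (rcosets H)" and \<beta>_S: "\<And>C. C \<in> rcosets H \<Longrightarrow> \<beta> C \<in> S"
    using \<beta> by (auto simp: based_injections_def)
  have rc: "H #> g \<in> rcosets H" if "g \<in> carrier G" for g
    using that H by (simp add: rcosetsI subgroup.subset)
  have \<beta>H: "\<beta> H \<in> S" using \<beta>_S[OF subgroup_in_rcosets[OF H]] .
  have O'E: "\<exists>g\<in>carrier G. s = \<beta> (H #> g)" if "s \<in> O'" for s
    using that by (auto simp: O'_def RCOSETS_def)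
  have \<beta>O': "\<beta> (H #> g) \<in> O'" if "g \<in> carrier G" for g
    using rc[OF that] by (auto simp: O'_def)
  have along: "\<phi> (\<beta> (H #> g), h) = \<beta> (H #> (g \<otimes> h))"
    if "\<phi> \<in> actions_along S H \<beta>" "g \<in> carrier G" "h \<in> carrier G" for \<phi> g h
  proof -
    have "\<phi> (\<beta> (H #> g), h) = \<phi> (\<phi> (\<beta> H, g), h)" using that by (simp add: actions_along_def)
    also have "\<dots> = \<phi> (\<beta> H, g \<otimes> h)"
      using that right_actionsD(3)[of \<phi> G S "\<beta> H" g h] \<beta>H by (simp add: actions_along_def)
    finally show ?thesis using that by (simp add: actions_along_def)
  qed
  \<comment> \<open>The complement of the orbit is invariant: if a point entered the orbit under
    \<open>g\<close>, then \<open>inv g\<close> would take it back to its start inside the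
    orbit.\<close>
  have R_closed: "\<phi> (s, g) \<in> ?R" if \<phi>: "\<phi> \<in> actions_along S H \<beta>" and s: "s \<in> ?R" and g: "g \<in> carrier G" for \<phi> s g
  proof -
    have act: "\<phi> \<in> right_actions G S" using \<phi> by (simp add: actions_along_def)
    have "\<phi> (s, g) \<notin> O'"
    proof
      assume "\<phi> (s, g) \<in> O'"
      then obtain h where h: "h \<in> carrier G" "\<phi> (s, g) = \<beta> (H #> h)" using O'E by blast
      have "s = \<phi> (s, g \<otimes> inv g)" using right_actionsD(2)[OF act] s g by simp
      also have "\<dots> = \<phi> (\<phi> (s, g), inv g)"
        using right_actionsD(3)[OF act, of s g "inv g"] s g by simp
      also have "\<dots> = \<beta> (H #> (h \<otimes> inv g))" using along[OF \<phi>] h g by simp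
      also have "\<dots> \<in> O'" using \<beta>O' h g by simp
      finally show False using s by simp
    qed
    then show ?thesis using right_actionsD(1)[OF act] s g by simp
  qed
  have restr: "restrict \<phi> (?R \<times> carrier G) \<in> right_actions G ?R" if \<phi>: "\<phi> \<in> actions_along S H \<beta>" for \<phi>
  proof -
    have "\<phi> \<in> right_actions G S" using \<phi> by (simp add: actions_along_def)
    then show ?thesis
      using R_closed[OF \<phi>] by (intro right_actionsI) (auto simp: right_actionsD)
  qed
  have "bij_betw (\<lambda>\<phi>. restrict \<phi> (?R \<times> carrier G)) (actions_along S H \<beta>) (right_actions G ?R)"
    unfolding bij_betw_def
  proof
    show "inj_on (\<lambda>\<phi>. restrict \<phi> (?R \<times> carrier G)) (actions_along S H \<beta>)"
    proof (rule inj_onI)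
      fix \<phi> \<psi> assume \<phi>: "\<phi> \<in> actions_along S H \<beta>" and \<psi>: "\<psi> \<in> actions_along S H \<beta>"
        and eq: "restrict \<phi> (?R \<times> carrier G) = restrict \<psi> (?R \<times> carrier G)"
      show "\<phi> = \<psi>"
      proof (rule right_actions_eqI)
        show "\<phi> \<in> right_actions G S" "\<psi> \<in> right_actions G S"
          using \<phi> \<psi> by (auto simp: actions_along_def)
        fix s g assume s: "s \<in> S" and g: "g \<in> carrier G"
        show "\<phi> (s, g) = \<psi> (s, g)"
        proof (cases "s \<in> O'")
          case True
          then show ?thesis using O'E along[OF \<phi>] along[OF \<psi>] g by fastforce
        next
          case False
          then show ?thesis using fun_cong[OF eq, of "(s, g)"] s g by simp
        qed
      qed
    qed
    have "\<exists>\<phi>\<in>actions_along S H \<beta>. restrict \<phi> (?R \<times> carrier G) = \<psi>" if \<psi>: "\<psi> \<in> right_actions G ?R" for \<psi>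
    proof -
      note a = right_actionsD[OF \<psi>]
      \<comment> \<open>Surjectivity: translation of cosets, transported to the orbit by
        \<open>\<beta>\<close>, is glued with the given action \<open>\<psi>\<close> on the
        complement.\<close>
      define \<phi> where "\<phi> = restrict (\<lambda>(s, g). if s \<in> O' then \<beta> (inv_into (rcosets H) \<beta> s #> g) else \<psi> (s, g)) (S \<times> carrier G)"
      have \<phi>_R: "\<phi> (s, g) = \<psi> (s, g)" if "s \<in> ?R" "g \<in> carrier G" for s g
        using that by (simp add: \<phi>_def)
      have \<phi>_O: "\<phi> (\<beta> (H #> g), h) = \<beta> (H #> (g \<otimes> h))" if g: "g \<in> carrier G" and h: "h \<in> carrier G" for g h
      proof -
        have "inv_into (rcosets H) \<beta> (\<beta> (H #> g)) = H #> g" using inj rc[OF g] by simp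
        then show ?thesis
          using \<beta>O'[OF g] \<beta>_S[OF rc[OF g]] h g coset_mult_assoc[OF subgroup.subset[OF H] g h]
          by (simp add: \<phi>_def)
      qed
      have "\<phi> \<in> right_actions G S"
      proof (rule right_actionsI)
        fix s assume s: "s \<in> S"
        have "(\<forall>g\<in>carrier G. \<phi> (s, g) \<in> S) \<and> \<phi> (s, \<one>) = s \<and>
            (\<forall>g\<in>carrier G. \<forall>h\<in>carrier G. \<phi> (s, g \<otimes> h) = \<phi> (\<phi> (s, g), h))"
        proof (cases "s \<in> O'")
          case True
          then obtain k where k: "k \<in> carrier G" "s = \<beta> (H #> k)" using O'E by blast
          then show ?thesis using \<phi>_O \<beta>_S rc by (simp add: m_assoc)
        next
          case False
          then have "s \<in> ?R" using s by simp
          then show ?thesis using a(1)[of s] a(2,3) \<phi>_R by auto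
        qed
        then show "\<phi> (s, \<one>) = s"
          and "\<And>g. g \<in> carrier G \<Longrightarrow> \<phi> (s, g) \<in> S"
          and "\<And>g h. g \<in> carrier G \<Longrightarrow> h \<in> carrier G \<Longrightarrow> \<phi> (s, g \<otimes> h) = \<phi> (\<phi> (s, g), h)"
          by blast+
      qed (simp add: \<phi>_def)
      moreover have "\<phi> (\<beta> H, g) = \<beta> (H #> g)" if "g \<in> carrier G" for g
        using \<phi>_O[OF one_closed that] that coset_mult_one[OF subgroup.subset[OF H]] by simp
      ultimately have "\<phi> \<in> actions_along S H \<beta>" by (simp add: actions_along_def)
      moreover have "restrict \<phi> (?R \<times> carrier G) = \<psi>"
        by (rule extensionalityI[OF _ a(4)]) (auto simp: \<phi>_R)
      ultimately show ?thesis by blast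
    qed
    then show "(\<lambda>\<phi>. restrict \<phi> (?R \<times> carrier G)) ` actions_along S H \<beta> = right_actions G ?R"
      using restr by force
  qed
  then show ?thesis by (simp add: O'_def)
qed

end

lemma (in monoid) trivial_right_action: "restrict fst (S \<times> carrier G) \<in> right_actions G S"
  by (intro right_actionsI) auto

text \<open>The product is the falling factorial m (m - 1) ... (m - j + 1), in the form in which
  \<open>card_inj_on_subset_funcset\<close> counts injections.\<close>

lemma prod_minus_mult_fact:
  "j \<le> m \<Longrightarrow> prod ((-) m) {0..<j} * fact (m - j) = (fact m :: nat)"
proof (induction j)
  case (Suc j)
  then have "fact (m - j) = (m - j) * (fact (m - Suc j) :: nat)"
    by (simp add: fact_reduce)
  then show ?case using Suc by (simp add: mult.assoc)
qed simp

text \<open>Deleting \<open>c\<close> identifies these maps with the injections of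
  \<open>C - {c}\<close> into \<open>S - {x}\<close>, which explains both decrements.\<close>

lemma card_inj_extend:
  assumes C: "finite C" "c \<in> C" and S: "finite S" "x \<in> S"
  shows "card {f \<in> C \<rightarrow>\<^sub>E S. inj_on f C \<and> f c = x} = prod ((-) (card S - 1)) {0..<card C - 1}"
proof -
  define B where "B = C - {c}"
  have CB: "C = insert c B" "c \<notin> B" using C by (auto simp: B_def)
  have "card {f \<in> C \<rightarrow>\<^sub>E S. inj_on f C \<and> f c = x} = card {f \<in> B \<rightarrow>\<^sub>E (S - {x}). inj_on f B}"
  proof (rule bij_betw_same_card[OF bij_betwI[where g = "\<lambda>f. f(c := x)"]])
    show "(\<lambda>f. restrict f B) \<in> {f \<in> C \<rightarrow>\<^sub>E S. inj_on f C \<and> f c = x} \<rightarrow> {f \<in> B \<rightarrow>\<^sub>E (S - {x}). inj_on f B}"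
    proof
      fix f assume f: "f \<in> {f \<in> C \<rightarrow>\<^sub>E S. inj_on f C \<and> f c = x}"
      then have "inj_on f B" "x \<notin> f ` B" using CB by (auto simp: inj_on_insert)
      moreover have "f b \<in> S" if "b \<in> B" for b using f that CB(1) by blast
      ultimately show "restrict f B \<in> {f \<in> B \<rightarrow>\<^sub>E (S - {x}). inj_on f B}"
        by (auto simp: inj_on_restrict_eq)
    qed
    show "(\<lambda>f. f(c := x)) \<in> {f \<in> B \<rightarrow>\<^sub>E (S - {x}). inj_on f B} \<rightarrow> {f \<in> C \<rightarrow>\<^sub>E S. inj_on f C \<and> f c = x}"
    proof
      fix f assume f: "f \<in> {f \<in> B \<rightarrow>\<^sub>E (S - {x}). inj_on f B}"
      then have "f(c := x) \<in> C \<rightarrow>\<^sub>E S"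
        unfolding CB(1) using S(2) by (intro PiE_I) (auto simp: PiE_iff extensional_def)
      moreover have "inj_on (f(c := x)) C"
      proof -
        have "inj_on (f(c := x)) B" using f CB(2) inj_on_cong[of B "f(c := x)" f] by fastforce
        moreover have "(f(c := x)) ` B \<subseteq> S - {x}" using f CB(2) by auto
        ultimately show ?thesis unfolding CB(1) inj_on_insert by auto
      qed
      ultimately show "f(c := x) \<in> {f \<in> C \<rightarrow>\<^sub>E S. inj_on f C \<and> f c = x}" by simp
    qed
    show "(restrict f B)(c := x) = f" if "f \<in> {f \<in> C \<rightarrow>\<^sub>E S. inj_on f C \<and> f c = x}" for f
    proof
      fix i
      have "f \<in> C \<rightarrow>\<^sub>E S" using that by simp
      then have "f i = undefined" if "i \<notin> C" using that by (rule PiE_arb)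
      then show "((restrict f B)(c := x)) i = f i" using that CB(1) by auto
    qed
    show "restrict (f(c := x)) B = f" if "f \<in> {f \<in> B \<rightarrow>\<^sub>E (S - {x}). inj_on f B}" for f
    proof
      fix i
      have "f \<in> B \<rightarrow>\<^sub>E S - {x}" using that by simp
      then have "f i = undefined" if "i \<notin> B" using that by (rule PiE_arb)
      then show "restrict (f(c := x)) B i = f i" using CB(2) by auto
    qed
  qed
  also have "\<dots> = prod ((-) (card (S - {x}))) {0..<card B}"
    using card_inj_on_subset_funcset[of B "S - {x}" B] S(1) C by (simp add: B_def)
  finally show ?thesis using S C by (simp add: B_def)
qed

context group
begin

lemma card_based_injections:
  assumes H: "subgroup H G" and S: "finite S" "x \<in> S" and fin: "finite (rcosets H)"
  shows "card (based_injections x S H) = prod ((-) (card S - 1)) {0..<card (rcosets H) - 1}"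
  using card_inj_extend[of "rcosets H" H S x] subgroup_in_rcosets[OF H] S fin
  unfolding based_injections_def by simp

text \<open>Sum over the pairs of stabilizer and labelling at \<open>x\<close>: a subgroup of index
  k has as many labellings as the falling factorial counts, and the card S - k points outside the
  orbit carry an arbitrary action. That only finitely many subgroups contribute is deduced from the
  finiteness of the set of actions.\<close>

lemma card_right_actions:
  assumes fin: "finite (right_actions G S)" and S: "finite S" "x \<in> S"
    and h: "\<And>R. R \<subset> S \<Longrightarrow> card (right_actions G R) = h (card R)"
  shows "card (right_actions G S) =
    (\<Sum>k=1..card S. subgroup_number G k * prod ((-) (card S - 1)) {0..<k - 1} * h (card S - k))"
proof -
  \<comment> \<open>\<open>card\<close> is 0 on infinite sets, so the lower bound 1 in
    \<open>N\<close> below discards subgroups of infinite index.\<close>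
  let ?ix = "\<lambda>H. card (rcosets H)"
  define I where "I = (SIGMA H:{H. subgroup H G}. based_injections x S H)"
  define N where "N = {H. subgroup H G \<and> ?ix H \<in> {1..card S}}"
  have card_im: "card (\<beta> ` (rcosets H)) = ?ix H" "\<beta> ` (rcosets H) \<subseteq> S"
    if "\<beta> \<in> based_injections x S H" for H \<beta>
    using that by (auto simp: based_injections_def card_image)
  have ix: "?ix H \<in> {1..card S}" "finite (rcosets H)" if "subgroup H G" "\<beta> \<in> based_injections x S H" for H \<beta>
  proof -
    show f: "finite (rcosets H)"
      using that card_im(2)[OF that(2)] S(1) finite_imageD[of \<beta> "rcosets H"] finite_subset
      by (auto simp: based_injections_def)
    have "rcosets H \<noteq> {}" using subgroup_in_rcosets[OF that(1)] by auto
    then show "?ix H \<in> {1..card S}"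
      using f card_im(1)[OF that(2)] card_mono[OF S(1) card_im(2)[OF that(2)]]
      by (simp add: Suc_le_eq card_gt_0_iff)
  qed
  have I_N: "I = (SIGMA H:N. based_injections x S H)"
    using ix(1) by (fastforce simp: I_def N_def)
  have disj: "actions_along S H \<beta> \<inter> actions_along S H' \<beta>' = {}"
    if "(H, \<beta>) \<in> I" "(H', \<beta>') \<in> I" "(H, \<beta>) \<noteq> (H', \<beta>')" for H \<beta> H' \<beta>'
    using that actions_along_disjoint[of H \<beta> x S H' \<beta>'] unfolding I_def by blast
  have card_along: "card (actions_along S H \<beta>) = h (card S - ?ix H)" and nonempty: "actions_along S H \<beta> \<noteq> {}"
    if "(H, \<beta>) \<in> I" for H \<beta>
  proof -
    have H: "subgroup H G" and \<beta>: "\<beta> \<in> based_injections x S H" using that by (auto simp: I_def)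
    note bij = bij_betw_actions_along[OF H \<beta>]
    have "\<beta> ` (rcosets H) \<noteq> {}" using subgroup_in_rcosets[OF H] by auto
    then have "S - \<beta> ` (rcosets H) \<subset> S" using card_im(2)[OF \<beta>] by blast
    moreover have "card (S - \<beta> ` (rcosets H)) = card S - ?ix H"
      using card_im[OF \<beta>] ix(2)[OF H \<beta>] by (simp add: card_Diff_subset)
    ultimately show "card (actions_along S H \<beta>) = h (card S - ?ix H)"
      using bij_betw_same_card[OF bij] h by simp
    \<comment> \<open>The trivial action on the complement of the orbit is a witness, via the
      bijection.\<close>
    show "actions_along S H \<beta> \<noteq> {}"
      using bij trivial_right_action by (metis bij_betw_empty1 empty_iff)
  qed
  have cover: "right_actions G S = (\<Union>(H, \<beta>)\<in>I. actions_along S H \<beta>)"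
    using ex_actions_along[OF _ S(2)] by (fastforce simp: I_def actions_along_def)
  have fin_I: "finite I"
  proof -
    \<comment> \<open>Choosing one action per pair is injective by disjointness, so the pairs
      inherit finiteness from the actions.\<close>
    have "inj_on (\<lambda>(H, \<beta>). SOME \<phi>. \<phi> \<in> actions_along S H \<beta>) I"
    proof (rule inj_onI, clarify)
      fix H \<beta> H' \<beta>'
      assume i: "(H, \<beta>) \<in> I" "(H', \<beta>') \<in> I"
        and eq: "(SOME \<phi>. \<phi> \<in> actions_along S H \<beta>) = (SOME \<phi>. \<phi> \<in> actions_along S H' \<beta>')"
      have "(SOME \<phi>. \<phi> \<in> actions_along S H \<beta>) \<in> actions_along S H \<beta>"
        "(SOME \<phi>. \<phi> \<in> actions_along S H' \<beta>') \<in> actions_along S H' \<beta>'"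
        using nonempty i by (simp_all add: some_in_eq)
      then show "H = H' \<and> \<beta> = \<beta>'" using disj[OF i] eq by auto
    qed
    moreover have "(\<lambda>(H, \<beta>). SOME \<phi>. \<phi> \<in> actions_along S H \<beta>) ` I \<subseteq> right_actions G S"
      unfolding cover using nonempty by (force simp: some_in_eq)
    ultimately show ?thesis using fin by (meson inj_on_finite)
  qed
  have based_card: "card (based_injections x S H) = prod ((-) (card S - 1)) {0..<?ix H - 1}" if "H \<in> N" for H
  proof (rule card_based_injections)
    show "finite (rcosets H)" using that by (auto simp: N_def intro: card_ge_0_finite)
  qed (use that S in \<open>auto simp: N_def\<close>)
  have "card (based_injections x S H) > 0" if "H \<in> N" for H
    using that based_card[OF that] by (auto simp: N_def)
  then have fin_b: "finite (based_injections x S H)" and ne_b: "based_injections x S H \<noteq> {}" if "H \<in> N" for H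
    using that by (auto simp: card_gt_0_iff)
  have "N \<subseteq> fst ` I" unfolding I_N using ne_b by force
  then have fin_N: "finite N" using fin_I finite_subset by blast
  have "card (right_actions G S) = (\<Sum>(H, \<beta>)\<in>I. card (actions_along S H \<beta>))"
  proof -
    have "finite (actions_along S H \<beta>)" for H \<beta>
      using fin by (rule finite_subset[rotated]) (auto simp: actions_along_def)
    moreover have "(case p of (H, \<beta>) \<Rightarrow> actions_along S H \<beta>) \<inter> (case q of (H, \<beta>) \<Rightarrow> actions_along S H \<beta>) = {}"
      if "p \<in> I" "q \<in> I" "p \<noteq> q" for p q
      using disj[of "fst p" "snd p" "fst q" "snd q"] that by (simp add: split_beta prod_eq_iff)
    ultimately show ?thesis
      unfolding cover using fin_I by (subst card_UN_disjoint) (simp_all add: split_beta)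
  qed
  also have "\<dots> = (\<Sum>(H, \<beta>)\<in>I. h (card S - ?ix H))"
    using card_along by (intro sum.cong) auto
  also have "\<dots> = (\<Sum>H\<in>N. \<Sum>\<beta>\<in>based_injections x S H. h (card S - ?ix H))"
    unfolding I_N using fin_N fin_b by (subst sum.Sigma) auto
  also have "\<dots> = (\<Sum>H\<in>N. prod ((-) (card S - 1)) {0..<?ix H - 1} * h (card S - ?ix H))"
    by (simp add: based_card)
  also have "\<dots> = (\<Sum>k=1..card S. \<Sum>H\<in>{H\<in>N. ?ix H = k}. prod ((-) (card S - 1)) {0..<?ix H - 1} * h (card S - ?ix H))"
    by (rule sum.group[symmetric]) (use fin_N in \<open>auto simp: N_def\<close>)
  also have "\<dots> = (\<Sum>k=1..card S. subgroup_number G k * prod ((-) (card S - 1)) {0..<k - 1} * h (card S - k))"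
  proof (rule sum.cong[OF HOL.refl])
    fix k assume k: "k \<in> {1..card S}"
    then have "{H \<in> N. ?ix H = k} = {H. subgroup H G \<and> ?ix H = k}" by (auto simp: N_def)
    then show "(\<Sum>H\<in>{H\<in>N. ?ix H = k}. prod ((-) (card S - 1)) {0..<?ix H - 1} * h (card S - ?ix H)) =
      subgroup_number G k * prod ((-) (card S - 1)) {0..<k - 1} * h (card S - k)"
      by (simp add: subgroup_number_def)
  qed
  finally show ?thesis .
qed

end

section \<open>The recursion for the number of actions on an n-set\<close>

fun action_count :: "(nat \<Rightarrow> nat) \<Rightarrow> nat \<Rightarrow> nat" where
  "action_count s n = (if n = 0 then 1
     else \<Sum>k=1..n. s k * prod ((-) (n - 1)) {0..<k - 1} * action_count s (n - k))"

declare action_count.simps [simp del]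

lemma action_count_0: "action_count s 0 = 1"
  by (simp add: action_count.simps)

text \<open>This is the coefficient of z^n in z F' = (sum of s(k) z^k) F, where F is the exponential
  generating function of \<open>action_count s\<close>. Division by (n - 1)! turns each falling
  factorial into the reciprocal of (n - k)!.\<close>

lemma action_count_rec:
  assumes "n > 0"
  shows "real (action_count s n) / fact (n - 1) = (\<Sum>k=1..n. s k * (action_count s (n - k) / fact (n - k)))"
proof -
  have "real (action_count s n) =
      (\<Sum>k=1..n. s k * real (prod ((-) (n - 1)) {0..<k - 1}) * action_count s (n - k))"
    using assms by (subst action_count.simps) simp
  also have "\<dots> = (\<Sum>k=1..n. fact (n - 1) * (s k * (action_count s (n - k) / fact (n - k))))"
  proof (rule sum.cong[OF HOL.refl])
    fix k assume "k \<in> {1..n}"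
    then have "prod ((-) (n - 1)) {0..<k - 1} * fact (n - k) = (fact (n - 1) :: nat)"
      using prod_minus_mult_fact[of "k - 1" "n - 1"] by (simp add: diff_le_mono)
    then have "real (prod ((-) (n - 1)) {0..<k - 1}) * fact (n - k) = fact (n - 1)"
      by (metis of_nat_fact of_nat_mult)
    then have "real (prod ((-) (n - 1)) {0..<k - 1}) = fact (n - 1) / fact (n - k)"
      by (intro eq_divide_imp) simp_all
    then show "s k * real (prod ((-) (n - 1)) {0..<k - 1}) * action_count s (n - k) =
        fact (n - 1) * (s k * (action_count s (n - k) / fact (n - k)))"
      by simp
  qed
  finally have "real (action_count s n) =
      fact (n - 1) * (\<Sum>k=1..n. s k * (action_count s (n - k) / fact (n - k)))"
    unfolding sum_distrib_left .
  then show ?thesis by (simp only: nonzero_mult_div_cancel_left[OF fact_nonzero])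
qed

lemma (in group) card_right_actions_eq:
  fixes S :: "'c set"
  assumes fin: "\<And>S :: 'c set. finite S \<Longrightarrow> finite (right_actions G S)" and S: "finite S"
  shows "card (right_actions G S) = action_count (subgroup_number G) (card S)"
  using S
proof (induction S rule: finite_psubset_induct)
  case (psubset S)
  show ?case
  proof (cases "S = {}")
    case True
    then show ?thesis by (simp add: right_actions_empty action_count_0)
  next
    case False
    then obtain x where x: "x \<in> S" by blast
    show ?thesis
      using card_right_actions[OF fin[OF psubset(1)] psubset(1) x psubset(2)] False psubset(1)
      by (subst action_count.simps) simp
  qed
qed

section \<open>Free products and cyclic groups\<close>

definition word_class :: "('a, 'c) monoid_scheme \<Rightarrow> ('b, 'd) monoid_scheme \<Rightarrow> ('a + 'b) list \<Rightarrow> ('a + 'b) list set" where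
  "word_class G H u = {w. free_prod_cong G H u w}"

text \<open>A right action processes the letters of a word from left to right, hence
  \<open>foldl\<close>.\<close>

definition word_action :: "('s \<times> 'a \<Rightarrow> 's) \<Rightarrow> ('s \<times> 'b \<Rightarrow> 's) \<Rightarrow> 's \<Rightarrow> ('a + 'b) list \<Rightarrow> 's" where
  "word_action f g = foldl (\<lambda>s. case_sum (\<lambda>x. f (s, x)) (\<lambda>y. g (s, y)))"

lemma word_action_closed:
  assumes "f \<in> right_actions G S" "g \<in> right_actions H S" "u \<in> lists (carrier G <+> carrier H)" "s \<in> S"
  shows "word_action f g s u \<in> S"
  using assms(3,4)
  by (induction u arbitrary: s)
     (auto simp: word_action_def right_actionsD(1)[OF assms(1)] right_actionsD(1)[OF assms(2)])

lemma word_action_append: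
  "word_action f g s (u @ v) = word_action f g (word_action f g s u) v"
  by (simp add: word_action_def)

text \<open>Each relation generating the congruence is an action axiom of one factor. The point
  \<open>s\<close> stays arbitrary because, in a concatenation, the second word starts from the
  point reached by the first.\<close>

lemma word_action_cong:
  assumes f: "f \<in> right_actions G S" and g: "g \<in> right_actions H S" and G: "group G" and H: "group H"
    and "free_prod_cong G H u v" "s \<in> S"
  shows "word_action f g s u = word_action f g s v"
  using assms(5,6)
proof (induction arbitrary: s)
  case (append u u' v v')
  then show ?case
    using free_prod_cong_in_lists[OF group.is_monoid[OF G] group.is_monoid[OF H]]
      word_action_closed[OF f g]
    by (metis word_action_append)
qed (auto simp: word_action_def right_actionsD(2,3)[OF f] right_actionsD(2,3)[OF g])

lemma word_class_in_carrier:
  "u \<in> lists (carrier G <+> carrier H) \<Longrightarrow> word_class G H u \<in> carrier (free_product G H)"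
  unfolding carrier_free_product_iff word_class_def by blast

lemma word_class_mult:
  "u \<in> lists (carrier G <+> carrier H) \<Longrightarrow> v \<in> lists (carrier G <+> carrier H) \<Longrightarrow>
    word_class G H u \<otimes>\<^bsub>free_product G H\<^esub> word_class G H v = word_class G H (u @ v)"
  unfolding word_class_def by (rule free_product_mult_class)

lemma word_class_one: "word_class G H [] = \<one>\<^bsub>free_product G H\<^esub>"
  by (simp add: word_class_def free_product_def)

lemma word_class_eq: "free_prod_cong G H u v \<Longrightarrow> word_class G H u = word_class G H v"
  unfolding word_class_def by (rule free_product_class_eq)

lemma right_actions_pullback:
  assumes \<phi>: "\<phi> \<in> right_actions K S"
    and \<iota>: "\<And>x. x \<in> carrier G \<Longrightarrow> \<iota> x \<in> carrier K" "\<iota> \<one>\<^bsub>G\<^esub> = \<one>\<^bsub>K\<^esub>"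
      "\<And>x y. x \<in> carrier G \<Longrightarrow> y \<in> carrier G \<Longrightarrow> \<iota> (x \<otimes>\<^bsub>G\<^esub> y) = \<iota> x \<otimes>\<^bsub>K\<^esub> \<iota> y"
    and G: "group G"
  shows "restrict (\<lambda>(s, x). \<phi> (s, \<iota> x)) (S \<times> carrier G) \<in> right_actions G S"
proof -
  interpret G: group G by fact
  show ?thesis
    by (rule right_actionsI) (auto simp: \<iota> right_actionsD[OF \<phi>])
qed

text \<open>Universal property in terms of actions: restriction to the letters is injective because
  words are products of letters, and surjective because a pair of actions lets words act compatibly
  with the congruence.\<close>

lemma bij_betw_right_actions_free_product:
  fixes G :: "('a, 'c) monoid_scheme" and H :: "('b, 'd) monoid_scheme"
  assumes G: "group G" and H: "group H"
  shows "bij_betw (\<lambda>\<phi>. (restrict (\<lambda>(s, x). \<phi> (s, word_class G H [Inl x])) (S \<times> carrier G),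
                       restrict (\<lambda>(s, y). \<phi> (s, word_class G H [Inr y])) (S \<times> carrier H)))
           (right_actions (free_product G H) S) (right_actions G S \<times> right_actions H S)"
    (is "bij_betw ?r _ _")
proof -
  let ?F = "free_product G H"
  let ?W = "lists (carrier G <+> carrier H)"
  let ?c = "word_class G H"
  have c_Inl: "?c [Inl (x \<otimes>\<^bsub>G\<^esub> y)] = ?c [Inl x] \<otimes>\<^bsub>?F\<^esub> ?c [Inl y]"
    if "x \<in> carrier G" "y \<in> carrier G" for x y
    using that word_class_eq[OF free_prod_cong.mult_left[OF that, of H]] by (simp add: word_class_mult InlI)
  have c_Inr: "?c [Inr (x \<otimes>\<^bsub>H\<^esub> y)] = ?c [Inr x] \<otimes>\<^bsub>?F\<^esub> ?c [Inr y]"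
    if "x \<in> carrier H" "y \<in> carrier H" for x y
    using that word_class_eq[OF free_prod_cong.mult_right[OF that, of G]] by (simp add: word_class_mult InrI)
  have c_one: "?c [Inl \<one>\<^bsub>G\<^esub>] = \<one>\<^bsub>?F\<^esub>" "?c [Inr \<one>\<^bsub>H\<^esub>] = \<one>\<^bsub>?F\<^esub>"
    using word_class_eq[OF free_prod_cong.one_left] word_class_eq[OF free_prod_cong.one_right]
    by (simp_all flip: word_class_one)
  show ?thesis
    unfolding bij_betw_def
  proof
    show "inj_on ?r (right_actions ?F S)"
    proof (rule inj_onI)
      fix \<phi> \<psi> assume \<phi>: "\<phi> \<in> right_actions ?F S" and \<psi>: "\<psi> \<in> right_actions ?F S" and eq: "?r \<phi> = ?r \<psi>"
      have letter: "\<phi> (s, ?c [a]) = \<psi> (s, ?c [a])" if "s \<in> S" "a \<in> carrier G <+> carrier H" for s a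
      proof (cases a)
        case (Inl x)
        then show ?thesis using that fun_cong[OF conjunct1[OF eq[unfolded prod.inject]], of "(s, x)"] by auto
      next
        case (Inr y)
        then show ?thesis using that fun_cong[OF conjunct2[OF eq[unfolded prod.inject]], of "(s, y)"] by auto
      qed
      have word: "\<phi> (s, ?c u) = \<psi> (s, ?c u)" if "u \<in> ?W" "s \<in> S" for u s
        using that
      proof (induction u arbitrary: s)
        case Nil
        then show ?case by (simp add: word_class_one right_actionsD(2)[OF \<phi>] right_actionsD(2)[OF \<psi>])
      next
        case (Cons a u)
        then have a: "[a] \<in> ?W" and u: "u \<in> ?W" by auto
        have "?c (a # u) = ?c [a] \<otimes>\<^bsub>?F\<^esub> ?c u" using word_class_mult[OF a u] by simp
        moreover have "\<phi> (s, ?c [a]) \<in> S"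
          using right_actionsD(1)[OF \<phi>] word_class_in_carrier[OF a] Cons.prems by simp
        ultimately show ?case
          using Cons letter[of s a] right_actionsD(3)[OF \<phi>] right_actionsD(3)[OF \<psi>]
            word_class_in_carrier[OF a] word_class_in_carrier[OF u]
          by auto
      qed
      show "\<phi> = \<psi>"
        by (rule right_actions_eqI[OF \<phi> \<psi>])
           (use word in \<open>auto simp: carrier_free_product_iff word_class_def\<close>)
    qed
    have onto: "\<exists>\<phi>\<in>right_actions ?F S. ?r \<phi> = (f, g)"
      if f: "f \<in> right_actions G S" and g: "g \<in> right_actions H S" for f g
    proof -
      \<comment> \<open>A class acts through any of its words; \<open>word_action_cong\<close> makes
        the choice irrelevant.\<close>
      define \<phi> where "\<phi> = restrict (\<lambda>(s, A). word_action f g s (SOME u. u \<in> A)) (S \<times> carrier ?F)"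
      have \<phi>: "\<phi> (s, ?c u) = word_action f g s u" if s: "s \<in> S" and u: "u \<in> ?W" for s u
      proof -
        have "(SOME w. w \<in> ?c u) \<in> ?c u"
          by (rule someI[of _ u]) (simp add: word_class_def free_prod_cong.refl u)
        then have "word_action f g s u = word_action f g s (SOME w. w \<in> ?c u)"
          using word_action_cong[OF f g G H _ s] by (simp add: word_class_def)
        then show ?thesis using s word_class_in_carrier[OF u] by (simp add: \<phi>_def)
      qed
      have classE: "\<exists>u\<in>?W. A = ?c u" if "A \<in> carrier ?F" for A
        using that by (auto simp: carrier_free_product_iff word_class_def)
      have "\<phi> \<in> right_actions ?F S"
      proof (rule right_actionsI)
        fix s assume s: "s \<in> S"
        show "\<phi> (s, \<one>\<^bsub>?F\<^esub>) = s"
          using \<phi>[OF s, of "[]"] by (simp add: word_class_one word_action_def)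
        fix A assume "A \<in> carrier ?F"
        then obtain u where u: "u \<in> ?W" "A = ?c u" using classE by blast
        show "\<phi> (s, A) \<in> S" using \<phi> word_action_closed[OF f g] u s by simp
        fix B assume "B \<in> carrier ?F"
        then obtain v where v: "v \<in> ?W" "B = ?c v" using classE by blast
        have "u @ v \<in> ?W" using u v by auto
        then show "\<phi> (s, A \<otimes>\<^bsub>?F\<^esub> B) = \<phi> (\<phi> (s, A), B)"
          using \<phi> word_action_closed[OF f g u(1) s] u v s by (simp add: word_class_mult word_action_append)
      qed (simp add: \<phi>_def)
      moreover have "?r \<phi> = (f, g)"
      proof (rule prod_eqI)
        show "fst (?r \<phi>) = fst (f, g)"
          unfolding fst_conv
          by (rule extensionalityI[OF _ right_actionsD(4)[OF f]])
             (auto simp: \<phi> InlI word_action_def)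
        show "snd (?r \<phi>) = snd (f, g)"
          unfolding snd_conv
          by (rule extensionalityI[OF _ right_actionsD(4)[OF g]])
             (auto simp: \<phi> InrI word_action_def)
      qed
      ultimately show ?thesis by blast
    qed
    have into: "?r \<phi> \<in> right_actions G S \<times> right_actions H S" if \<phi>: "\<phi> \<in> right_actions ?F S" for \<phi>
      using right_actions_pullback[OF \<phi> _ c_one(1) c_Inl G] right_actions_pullback[OF \<phi> _ c_one(2) c_Inr H]
      by (simp add: word_class_in_carrier InlI InrI)
    show "?r ` right_actions ?F S = right_actions G S \<times> right_actions H S"
    proof (rule equalityI)
      show "right_actions G S \<times> right_actions H S \<subseteq> ?r ` right_actions ?F S"
      proof
        fix p assume "p \<in> right_actions G S \<times> right_actions H S"
        then have "\<exists>\<phi>\<in>right_actions ?F S. ?r \<phi> = (fst p, snd p)" by (intro onto) auto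
        then obtain \<phi> where "\<phi> \<in> right_actions ?F S" "?r \<phi> = p" by auto
        then show "p \<in> ?r ` right_actions ?F S" by blast
      qed
    qed (use into in blast)
  qed
qed

section \<open>Subgroups and actions of cyclic groups of prime order\<close>

lemma (in group) subgroup_number_prime_order:
  assumes p: "prime (Coset.order G)"
  shows "subgroup_number G k = (if k = 1 \<or> k = Coset.order G then 1 else 0)"
proof -
  have fin: "finite (carrier G)" using p not_prime_0 by (metis order_gt_0_iff_finite neq0_conv)
  \<comment> \<open>By Lagrange the index divides the prime order, so only the whole group and the
    trivial subgroup can occur.\<close>
  have lagr: "card (rcosets H) * card H = Coset.order G" "H \<subseteq> carrier G" "finite H" if "subgroup H G" for H
    using that lagrange_finite[OF fin] subgroup.subset[OF that] finite_subset[OF _ fin] by auto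
  have card: "card (rcosets (carrier G)) = 1"
    using lagr(1)[OF subgroup_self] p by (auto simp: Coset.order_def)
  have card1: "card (rcosets {\<one>}) = Coset.order G"
    using lagr(1)[OF triv_subgroup] by simp
  have "Coset.order G > 1" using p by (rule prime_gt_1_nat)
  consider "k = 1" | "k = Coset.order G" "k \<noteq> 1" | "k \<noteq> 1" "k \<noteq> Coset.order G" by blast
  then show ?thesis
  proof cases
    case 1
    have "H = carrier G" if "subgroup H G" "card (rcosets H) = k" for H
      using lagr(1,2)[OF that(1)] that(2) 1 by (intro card_subset_eq[OF fin]) (auto simp: Coset.order_def)
    then have "{H. subgroup H G \<and> card (rcosets H) = k} = {carrier G}"
      using card subgroup_self unfolding 1 by blast
    then show ?thesis using 1 by (simp add: subgroup_number_def)
  next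
    case 2
    have "H = {\<one>}" if "subgroup H G" "card (rcosets H) = k" for H
    proof -
      have "card H = 1" using lagr(1)[OF that(1)] that(2) 2 \<open>Coset.order G > 1\<close> by simp
      then show ?thesis using subgroup.one_closed[OF that(1)] by (metis card_1_singletonE singletonD)
    qed
    then have "{H. subgroup H G \<and> card (rcosets H) = k} = {{\<one>}}"
      using card1 triv_subgroup unfolding 2(1) by blast
    then show ?thesis using 2 by (simp add: subgroup_number_def)
  next
    case 3
    have "k dvd Coset.order G" if "subgroup H G" "card (rcosets H) = k" for H
      using lagr(1)[OF that(1)] that(2) by (metis dvd_triv_left)
    then have none: "{H. subgroup H G \<and> card (rcosets H) = k} = {}"
      using p 3 by (auto simp: prime_nat_iff)
    show ?thesis unfolding subgroup_number_def none using 3 by simp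
  qed
qed

lemma order_integer_mod_group: "n > 0 \<Longrightarrow> Coset.order (integer_mod_group n) = n"
  by (simp add: Coset.order_def carrier_integer_mod_group)

text \<open>The orbit of the base point has size 1 or q, so two terms of the recursion survive. The
  case distinction is required because for n < q the index k = q is outside the sum, while the
  truncated \<open>n - q\<close> would be 0.\<close>

lemma action_count_integer_mod_group:
  assumes q: "prime q" and n: "n > 0"
  shows "real (action_count (subgroup_number (integer_mod_group q)) n) / fact (n - 1) =
    action_count (subgroup_number (integer_mod_group q)) (n - 1) / fact (n - 1)
    + (if n < q then 0 else action_count (subgroup_number (integer_mod_group q)) (n - q) / fact (n - q))"
proof -
  have q1: "q > 1" using q by (rule prime_gt_1_nat)
  let ?h = "action_count (subgroup_number (integer_mod_group q))"
  let ?t = "\<lambda>k. ?h (n - k) / fact (n - k) :: real"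
  have s: "subgroup_number (integer_mod_group q) k = (if k = 1 \<or> k = q then 1 else 0)" for k
    using group.subgroup_number_prime_order[of "integer_mod_group q" k] q q1
    by (simp add: order_integer_mod_group)
  have "?h n / fact (n - 1) = (\<Sum>k=1..n. (if k = 1 then ?t k else 0) + (if k = q then ?t k else 0))"
    unfolding action_count_rec[OF n] by (rule sum.cong) (use q1 in \<open>auto simp: s\<close>)
  also have "\<dots> = ?t 1 + (if n < q then 0 else ?t q)"
    using n q1 by (simp add: sum.distrib)
  finally show ?thesis .
qed

text \<open>Both sides count actions on \<open>{..<n}\<close>. Finiteness for the free product is
  inherited from the finite factors through the bijection.\<close>

lemma action_count_free_product:
  fixes G :: "('a, 'c) monoid_scheme" and H :: "('b, 'd) monoid_scheme"
  assumes G: "group G" "finite (carrier G)" and H: "group H" "finite (carrier H)"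
  shows "action_count (subgroup_number (free_product G H)) n =
    action_count (subgroup_number G) n * action_count (subgroup_number H) n"
proof -
  interpret G: group G by fact
  interpret H: group H by fact
  interpret F: group "free_product G H" by (rule group_free_product) fact+
  have bij: "\<exists>r. bij_betw r (right_actions (free_product G H) S) (right_actions G S \<times> right_actions H S)"
    for S :: "nat set"
    using bij_betw_right_actions_free_product[OF G(1) H(1)] by blast
  have fin: "finite (right_actions (free_product G H) S)" if "finite S" for S :: "nat set"
    using bij[of S] bij_betw_finite finite_right_actions[OF G(2) that] finite_right_actions[OF H(2) that]
    by blast
  have "card (right_actions (free_product G H) {..<n}) =
      card (right_actions G {..<n}) * card (right_actions H {..<n})"
    using bij[of "{..<n}"] by (metis bij_betw_same_card card_cartesian_product)
  then show ?thesis
    using F.card_right_actions_eq[OF fin, of "{..<n}"]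
      G.card_right_actions_eq[OF finite_right_actions[OF G(2)], of "{..<n}"]
      H.card_right_actions_eq[OF finite_right_actions[OF H(2)], of "{..<n}"]
    by simp
qed

section \<open>The system of moment quotients\<close>

text \<open>The recursion of the moments m_j from the overview. The ring is generic because the
  moments are real series and their quotients integral ones. At j = 0 the truncated index
  \<open>j - 1\<close> is harmless, its factor being 0.\<close>

definition hecke5_system :: "(nat \<Rightarrow> 'a::comm_ring_1 fps) \<Rightarrow> bool" where
  "hecke5_system x \<longleftrightarrow>
     (\<forall>j. x (Suc j) = (1 + fps_X) * x j + of_nat j * x (j - 1) + fps_X ^ 5 * x (j + 4))"

lemma hecke5_system_nth:
  assumes "hecke5_system x"
  shows "x (Suc j) $ n = x j $ n + (if n = 0 then 0 else x j $ (n - 1)) + of_nat j * x (j - 1) $ n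
           + (if n < 5 then 0 else x (j + 4) $ (n - 5))"
proof -
  have *: "x (Suc j) = x j + fps_X * x j + fps_const (of_nat j) * x (j - 1) + fps_X ^ 5 * x (j + 4)"
    using assms unfolding hecke5_system_def by (simp add: fps_of_nat algebra_simps)
  show ?thesis unfolding * by (simp add: fps_X_power_mult_nth)
qed

lemma hecke5_system_iff_nth:
  "hecke5_system x \<longleftrightarrow> (\<forall>j n. x (Suc j) $ n = x j $ n + (if n = 0 then 0 else x j $ (n - 1))
     + of_nat j * x (j - 1) $ n + (if n < 5 then 0 else x (j + 4) $ (n - 5)))"
proof
  assume *: "\<forall>j n. x (Suc j) $ n = x j $ n + (if n = 0 then 0 else x j $ (n - 1))
     + of_nat j * x (j - 1) $ n + (if n < 5 then 0 else x (j + 4) $ (n - 5))"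
  have "x (Suc j) = x j + fps_X * x j + fps_const (of_nat j) * x (j - 1) + fps_X ^ 5 * x (j + 4)" for j
    by (rule fps_ext) (simp add: * fps_X_power_mult_nth)
  then show "hecke5_system x"
    unfolding hecke5_system_def by (simp add: fps_of_nat algebra_simps)
qed (blast intro: hecke5_system_nth)

text \<open>
  The factor \<open>X\<^sup>5\<close> makes the system a contraction, so a solution is determined by its \<open>0\<close>-th
  entry. Allowing an error divisible by \<open>d\<close> covers both \<open>d = 0\<close> and congruences.
\<close>

lemma hecke5_system_dvd:
  fixes x :: "nat \<Rightarrow> 'a::comm_ring_1 fps"
  assumes step: "\<And>j n. d dvd x (Suc j) $ n - (x j $ n + (if n = 0 then 0 else x j $ (n - 1))
            + of_nat j * x (j - 1) $ n + (if n < 5 then 0 else x (j + 4) $ (n - 5)))"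
    and zero: "\<And>n. d dvd x 0 $ n"
  shows "d dvd x j $ n"
\<comment> \<open>Lexicographic induction: the n-th coefficient at index \<open>Suc j\<close>
  involves earlier coefficients at arbitrary indices and n-th coefficients at smaller
  indices.\<close>
proof (induction n arbitrary: j rule: less_induct)
  case (less n)
  show ?case
  proof (induction j rule: less_induct)
    case (less i)
    show ?case
    proof (cases i)
      case 0
      then show ?thesis by (simp add: zero)
    next
      case (Suc j)
      have "d dvd x j $ n" using less Suc by simp
      moreover have "d dvd (if n = 0 then 0 else x j $ (n - 1))"
        using \<open>\<And>y j. y < n \<Longrightarrow> d dvd x j $ y\<close> by simp
      moreover have "d dvd of_nat j * x (j - 1) $ n"
        using less Suc by (cases j) auto
      moreover have "d dvd (if n < 5 then 0 else x (j + 4) $ (n - 5))"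
        using \<open>\<And>y j. y < n \<Longrightarrow> d dvd x j $ y\<close> by simp
      ultimately have "d dvd x j $ n + (if n = 0 then 0 else x j $ (n - 1))
            + of_nat j * x (j - 1) $ n + (if n < 5 then 0 else x (j + 4) $ (n - 5))"
        by (intro dvd_add)
      then show ?thesis
        using dvd_add[OF step[of j n]] Suc by fastforce
    qed
  qed
qed

section \<open>The integral solution of the system with 0-th entry 1\<close>

function hecke5_coeff :: "nat \<Rightarrow> nat \<Rightarrow> int" where
  "hecke5_coeff 0 n = (if n = 0 then 1 else 0)"
| "hecke5_coeff (Suc j) n = hecke5_coeff j n + (if n = 0 then 0 else hecke5_coeff j (n - 1))
     + (if j = 0 then 0 else int j * hecke5_coeff (j - 1) n)
     + (if n < 5 then 0 else hecke5_coeff (j + 4) (n - 5))"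
  by pat_completeness auto
termination
  \<comment> \<open>The coefficient index comes first: the entry index grows to j + 4 only where the
    coefficient index drops by 5.\<close>
  by (relation "measures [snd, fst]") auto

definition hecke5_fps :: "nat \<Rightarrow> int fps" where
  "hecke5_fps j = Abs_fps (hecke5_coeff j)"

lemma hecke5_fps_0: "hecke5_fps 0 = 1"
  by (rule fps_ext) (simp add: hecke5_fps_def)

text \<open>The defining equations are the system read coefficientwise. They involve no division,
  which is the source of the integrality of the quotients m_j / F.\<close>

lemma hecke5_system_fps: "hecke5_system hecke5_fps"
  unfolding hecke5_system_iff_nth by (auto simp: hecke5_fps_def)

lemma fps_const_int: "fps_const c = (of_int c :: int fps)"
  using fps_of_int[where 'a = int, of c] by (simp only: of_int_eq_id id_apply)

lemma fps_of_int_dvdI: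
  fixes f :: "int fps"
  assumes "\<And>n. M dvd f $ n"
  shows "of_int M dvd f"
proof -
  have "f = fps_const M * Abs_fps (\<lambda>n. f $ n div M)"
    by (rule fps_ext) (use assms in simp)
  then have "fps_const M dvd f" by (metis dvd_triv_left)
  then show ?thesis by (simp only: fps_const_int)
qed

text \<open>
  Modulo a divisor of \<open>q\<close>, the system is invariant under shifting the index by \<open>q\<close>, so the shifted
  solution is a multiple of the original one.
\<close>

lemma hecke5_fps_shift:
  assumes "M dvd q"
  shows "of_int (int M) dvd hecke5_fps (j + q) - hecke5_fps q * hecke5_fps j"
proof (rule fps_of_int_dvdI)
  let ?u = hecke5_fps
  let ?x = "\<lambda>j. ?u (j + q) - ?u q * ?u j"
  note sys = hecke5_system_fps[unfolded hecke5_system_def, rule_format]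
  fix n
  show "int M dvd ?x j $ n"
  proof (rule hecke5_system_dvd)
    show "int M dvd ?x 0 $ n" for n by (simp add: hecke5_fps_0)
  next
    fix j n
    \<comment> \<open>The error made by the shifted sequence in the system: the factor j + q
      replaces j, and M divides q. The case j = 0 is separate because there \<open>j + q - 1\<close>
      and \<open>j - 1 + q\<close> may differ.\<close>
    let ?e = "of_nat (j + q) * ?u (j + q - 1) - of_nat j * ?u (j - 1 + q)"
    have e: "of_int (int M) dvd ?e"
    proof (cases j)
      case 0
      then have "?e = of_int (int M) * (of_nat (q div M) * ?u (q - 1))"
        using assms by (simp flip: of_nat_mult mult.assoc)
      then show ?thesis by (metis dvd_triv_left)
    next
      case (Suc i)
      then have "?e = of_nat q * ?u (i + q)" by (simp add: algebra_simps)
      then have "?e = of_int (int M) * (of_nat (q div M) * ?u (i + q))"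
        using assms by (simp flip: of_nat_mult mult.assoc)
      then show ?thesis by (metis dvd_triv_left)
    qed
    define y where "y = ?x (Suc j) - (?x j + fps_X * ?x j + fps_const (of_nat j) * ?x (j - 1) + fps_X ^ 5 * ?x (j + 4))"
    have "y = ?e"
      unfolding y_def using sys[of "j + q"] sys[of j]
      by (simp add: fps_of_nat algebra_simps)
    then have "of_int (int M) dvd y" using e by simp
    then obtain w where "y = fps_const (int M) * w"
      unfolding fps_const_int dvd_def by blast
    then have "int M dvd y $ n" by simp
    then show "int M dvd ?x (Suc j) $ n - (?x j $ n + (if n = 0 then 0 else ?x j $ (n - 1))
            + of_nat j * ?x (j - 1) $ n + (if n < 5 then 0 else ?x (j + 4) $ (n - 5)))"
      unfolding y_def by (simp add: fps_X_power_mult_nth)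
  qed
qed

section \<open>The quotients as Laurent series in z^(1/3)\<close>

definition hecke5_fls :: "nat \<Rightarrow> int fls" where
  "hecke5_fls j = fls_compose_power (fps_to_fls (hecke5_fps j)) 3"

lemma hecke5_fls_0: "hecke5_fls 0 = 1"
  by (simp add: hecke5_fls_def hecke5_fps_0)

lemma fls_compose_power_of_nat: "d > 0 \<Longrightarrow> fls_compose_power (of_nat n) d = of_nat n"
  by (simp add: fls_of_nat)

lemma hecke5_fls_Suc:
  "hecke5_fls (Suc j) = (1 + fls_X ^ 3) * hecke5_fls j + of_nat j * hecke5_fls (j - 1)
     + fls_X ^ 15 * hecke5_fls (j + 4)"
  unfolding hecke5_fls_def
  using hecke5_system_fps[unfolded hecke5_system_def, rule_format, of j]
  by (simp add: fls_times_fps_to_fls fps_to_fls_power fps_to_fls_of_nat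
        fls_compose_power_of_nat fls_X_power_conv_shift_1)

lemma hecke5_fls_shift:
  assumes "2 ^ m dvd q"
  shows "2 ^ m dvd hecke5_fls (j + q) - hecke5_fls q * hecke5_fls j"
proof -
  have "of_int (int (2 ^ m)) dvd hecke5_fps (j + q) - hecke5_fps q * hecke5_fps j"
    using assms by (intro hecke5_fps_shift)
  then obtain w where "hecke5_fps (j + q) - hecke5_fps q * hecke5_fps j = 2 ^ m * w"
    by (auto simp: dvd_def)
  then have "hecke5_fps (j + q) = hecke5_fps q * hecke5_fps j + 2 ^ m * w"
    by (simp add: algebra_simps)
  then have "hecke5_fls (j + q) = hecke5_fls q * hecke5_fls j +
      fls_compose_power (2 ^ m) 3 * fls_compose_power (fps_to_fls w) 3"
    unfolding hecke5_fls_def by (simp add: fls_times_fps_to_fls fps_to_fls_power)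
  also have "fls_compose_power (2 ^ m) 3 = (2 ^ m :: int fls)"
    by (metis fls_compose_power_of_nat of_nat_numeral of_nat_power zero_less_numeral)
  finally show ?thesis by simp
qed

text \<open>Eliminate the entries 2i + 4 and 2i + 5 from the instances j = 2i, 2i + 1, 2i + 4 of the
  system, where a, b, n in \<open>ring\<close> stand for z, z^5, i. The remainder is kept exactly,
  not just modulo 2, since its factor 2 later raises the precision from 2^m to 2^(m+1).\<close>

lemma hecke5_fls_even_step:
  "fls_X ^ 30 * hecke5_fls (2 * i + 8) = hecke5_fls (2 * i + 2) + fls_X ^ 6 * hecke5_fls (2 * i)
     + 2 * ((fls_X ^ 3 - of_nat i) * hecke5_fls (2 * i) - (1 + fls_X ^ 3) * hecke5_fls (2 * i + 1)
           + of_nat i * (1 + fls_X ^ 3) * hecke5_fls (2 * i - 1)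
           - of_nat (i + 2) * fls_X ^ 15 * hecke5_fls (2 * i + 3))"
proof -
  have ring: "b\<^sup>2 * u8 = u2 + a\<^sup>2 * u0 + 2 * ((a - n) * u0 - (1 + a) * u1 + n * (1 + a) * v - (n + 2) * b * u3)"
    if u1: "u1 = (1 + a) * u0 + 2 * n * v + b * u4"
      and u2: "u2 = (1 + a) * u1 + (2 * n + 1) * u0 + b * u5"
      and u5: "u5 = (1 + a) * u4 + (2 * n + 4) * u3 + b * u8"
    for a b n u0 u1 u2 u3 u4 u5 u8 v :: "int fls"
  proof -
    have e: "b * u4 = u1 - (1 + a) * u0 - 2 * n * v" "b * u5 = u2 - (1 + a) * u1 - (2 * n + 1) * u0"
      using u1 u2 by simp_all
    have "b\<^sup>2 * u8 = b * u5 - (1 + a) * (b * u4) - (2 * n + 4) * b * u3"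
      unfolding u5 by (simp add: algebra_simps power2_eq_square)
    then show ?thesis unfolding e by (simp add: algebra_simps power2_eq_square)
  qed
  have X: "(fls_X ^ 15)\<^sup>2 = (fls_X ^ 30 :: int fls)" "(fls_X ^ 3)\<^sup>2 = (fls_X ^ 6 :: int fls)"
    by (simp_all flip: power_mult)
  have u1: "hecke5_fls (2 * i + 1) = (1 + fls_X ^ 3) * hecke5_fls (2 * i)
      + 2 * of_nat i * hecke5_fls (2 * i - 1) + fls_X ^ 15 * hecke5_fls (2 * i + 4)"
    using hecke5_fls_Suc[of "2 * i"] by simp
  have u2: "hecke5_fls (2 * i + 2) = (1 + fls_X ^ 3) * hecke5_fls (2 * i + 1)
      + (2 * of_nat i + 1) * hecke5_fls (2 * i) + fls_X ^ 15 * hecke5_fls (2 * i + 5)"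
    using hecke5_fls_Suc[of "2 * i + 1"] by (simp add: eval_nat_numeral add_ac)
  have u5: "hecke5_fls (2 * i + 5) = (1 + fls_X ^ 3) * hecke5_fls (2 * i + 4)
      + (2 * of_nat i + 4) * hecke5_fls (2 * i + 3) + fls_X ^ 15 * hecke5_fls (2 * i + 8)"
    using hecke5_fls_Suc[of "2 * i + 4"] by (simp add: eval_nat_numeral add_ac)
  show ?thesis
    using ring[OF u1 u2 u5] by (simp only: X of_nat_add of_nat_numeral)
qed

lemma hecke5_system_mult_diff:
  "hecke5_system x \<Longrightarrow> hecke5_system y \<Longrightarrow> hecke5_system (\<lambda>j. x j * c - y j)"
  unfolding hecke5_system_def by (simp add: algebra_simps)

section \<open>Moments of the action counts and the subgroup numbers\<close>

context
  fixes a b :: "nat \<Rightarrow> nat" and m :: "nat \<Rightarrow> real fps"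
  defines "a \<equiv> action_count (subgroup_number (integer_mod_group 2))"
    and "b \<equiv> action_count (subgroup_number (integer_mod_group 5))"
    and "m \<equiv> \<lambda>j. Abs_fps (\<lambda>n. a (n + j) * b n / fact n)"
begin

text \<open>The new point is either fixed or exchanged with one of the n others.\<close>

lemma involution_count_Suc: "real (a (Suc n)) = a n + n * a (n - 1)"
proof (cases n)
  case 0
  then show ?thesis
    using action_count_integer_mod_group[of 2 1] by (simp add: a_def)
next
  case (Suc k)
  have "prime (2 :: nat)" by (rule two_is_prime_nat)
  from action_count_integer_mod_group[OF this, of "Suc n"] Suc
  have eq: "real (a (Suc n)) / (real n * fact k) = a n / (real n * fact k) + a k / fact k"
    by (simp add: a_def distrib_right)
  have cancel: "x = y + real n * z" if "x / (n * c) = y / (n * c) + z / c" "c \<noteq> 0" for x y z c :: real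
    using that Suc by (simp add: field_simps del: of_nat_Suc)
  show ?thesis using cancel[OF eq fact_nonzero] Suc by (simp add: distrib_right)
qed

lemma order5_count:
  assumes "n > 0"
  shows "real (b n) / fact (n - 1) = b (n - 1) / fact (n - 1) + (if n < 5 then 0 else b (n - 5) / fact (n - 5))"
proof -
  have "prime (5 :: nat)" by simp
  from action_count_integer_mod_group[OF this assms] show ?thesis by (simp add: b_def)
qed

text \<open>Expand a(n + j + 1) = a(n + j) + (n + j) a(n + j - 1). The part with factor j gives j
  m_(j-1); in the part with factor n, the recursion for n b(n) / n! gives z m_j + z^5
  m_(j+4).\<close>

lemma hecke5_system_moments: "hecke5_system m"
  unfolding hecke5_system_iff_nth
proof (intro allI)
  fix j n
  have b: "real n * (b n / fact n) = (if n = 0 then 0 else b (n - 1) / fact (n - 1))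
      + (if n < 5 then 0 else b (n - 5) / fact (n - 5))"
  proof (cases "n = 0")
    case False
    then have "real n * (b n / fact n) = b n / fact (n - 1)"
      by (simp add: fact_reduce)
    then show ?thesis using order5_count[of n] False by simp
  qed simp
  have "real (a (n + Suc j)) = a (n + j) + real j * a (n + j - 1) + real n * a (n + j - 1)"
    using involution_count_Suc[of "n + j"] by (simp add: algebra_simps)
  then have "m (Suc j) $ n = (a (n + j) + real j * a (n + j - 1) + real n * a (n + j - 1)) * (b n / fact n)"
    by (simp add: m_def)
  also have "\<dots> = a (n + j) * b n / fact n + real j * (a (n + j - 1) * b n / fact n)
      + a (n + j - 1) * (real n * (b n / fact n))"
    by (simp add: algebra_simps)
  also have "real j * (a (n + j - 1) * b n / fact n) = of_nat j * m (j - 1) $ n"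
    by (cases j) (simp_all add: m_def)
  also have "a (n + j - 1) * (real n * (b n / fact n)) =
      (if n = 0 then 0 else m j $ (n - 1)) + (if n < 5 then 0 else m (j + 4) $ (n - 5))"
  proof (cases "n = 0")
    case False
    moreover have "n - 1 + j = n + j - 1" "n \<ge> 5 \<Longrightarrow> n - 5 + (j + 4) = n + j - 1" using False by auto
    ultimately show ?thesis unfolding b by (simp add: m_def distrib_left)
  qed simp
  finally show "m (Suc j) $ n = m j $ n + (if n = 0 then 0 else m j $ (n - 1)) + of_nat j * m (j - 1) $ n
      + (if n < 5 then 0 else m (j + 4) $ (n - 5))"
    by (simp add: m_def)
qed

text \<open>Since n a(n) = a(n + 2) - a(n + 1) - a(n), the operator z d/dz on m_0 is expressed by
  moments.\<close>

lemma moment_deriv: "fps_X * fps_deriv (m 0) = m 2 - m 1 - m 0"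
proof (rule fps_ext)
  fix n
  have "real (a (n + 2)) = a (n + 1) + (n + 1) * a n"
    using involution_count_Suc[of "n + 1"] by simp
  then have "(m 2 - m 1 - m 0) $ n = n * (m 0 $ n)"
    by (simp add: m_def field_simps)
  then show "(fps_X * fps_deriv (m 0)) $ n = (m 2 - m 1 - m 0) $ n"
    by (cases n) (simp_all del: of_nat_Suc)
qed

text \<open>As a(n) b(n) counts the actions of the Hecke group, m_0 is the series F, and this is z
  F' = z S F.\<close>

lemma moment_log_deriv:
  "fps_X * fps_deriv (m 0) = Abs_fps (\<lambda>n. if n = 0 then 0 else real (subgroup_number (hecke_group 5) n)) * m 0"
proof (rule fps_ext)
  fix n
  let ?s = "subgroup_number (hecke_group 5)"
  have h: "real (action_count ?s k) = a k * b k" for k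
    using action_count_free_product[of "integer_mod_group 2" "integer_mod_group 5" k]
    by (simp add: a_def b_def hecke_group_def carrier_integer_mod_group)
  show "(fps_X * fps_deriv (m 0)) $ n = (Abs_fps (\<lambda>n. if n = 0 then 0 else real (?s n)) * m 0) $ n"
  proof (cases "n = 0")
    case False
    then have n: "n > 0" by simp
    have "(fps_X * fps_deriv (m 0)) $ n = real (action_count ?s n) / fact (n - 1)"
      using False by (simp add: m_def h fact_reduce)
    also have "\<dots> = (\<Sum>k=1..n. ?s k * (m 0 $ (n - k)))"
      unfolding action_count_rec[OF n] by (simp add: h m_def)
    also have "\<dots> = (\<Sum>k=0..n. (if k = 0 then 0 else ?s k) * (m 0 $ (n - k)))"
      by (rule sum.mono_neutral_cong_left) auto
    also have "\<dots> = (Abs_fps (\<lambda>n. if n = 0 then 0 else real (?s n)) * m 0) $ n"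
      unfolding fps_mult_nth by (rule sum.cong) auto
    finally show ?thesis .
  qed (simp add: fps_mult_nth)
qed

text \<open>Over the reals, \<open>U j * m 0\<close> and \<open>m j\<close> solve the system with
  the same 0-th entry, hence agree. Comparing the two expressions for z F' and cancelling
  \<open>m 0\<close> then gives z S.\<close>

lemma hecke5_fps_subgroup_number:
  "hecke5_fps 2 - hecke5_fps 1 - 1 = fps_X * Abs_fps (\<lambda>n. int (subgroup_number (hecke_group 5) (n + 1)))"
proof -
  define U :: "nat \<Rightarrow> real fps" where "U j = Abs_fps (\<lambda>n. of_int (hecke5_fps j $ n))" for j
  have "hecke5_system U"
    unfolding hecke5_system_iff_nth
    by (auto simp: U_def hecke5_system_nth[OF hecke5_system_fps])
  then have sys: "hecke5_system (\<lambda>j. U j * m 0 - m j)"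
    using hecke5_system_moments by (rule hecke5_system_mult_diff)
  have "U 0 = 1" by (rule fps_ext) (simp add: U_def hecke5_fps_0)
  then have zero: "U 0 * m 0 - m 0 = 0" by simp
  \<comment> \<open>Divisibility by 0 means vanishing: this is the uniqueness of the
    solution.\<close>
  have "0 dvd (U j * m 0 - m j) $ n" for j n
  proof (rule hecke5_system_dvd)
    show "0 dvd (U 0 * m 0 - m 0) $ n" for n unfolding zero by simp
  next
    fix j n
    show "0 dvd (U (Suc j) * m 0 - m (Suc j)) $ n - ((U j * m 0 - m j) $ n
        + (if n = 0 then 0 else (U j * m 0 - m j) $ (n - 1)) + of_nat j * (U (j - 1) * m 0 - m (j - 1)) $ n
        + (if n < 5 then 0 else (U (j + 4) * m 0 - m (j + 4)) $ (n - 5)))"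
      unfolding hecke5_system_nth[OF sys] by (simp only: diff_self dvd_refl)
  qed
  then have U: "U j * m 0 = m j" for j
    by (intro fps_ext) (simp add: fps_eq_iff)
  have "m 0 $ 0 = 1" by (simp add: m_def a_def b_def action_count_0)
  then have "m 0 \<noteq> 0" by auto
  moreover have "(U 2 - U 1 - 1) * m 0 =
      Abs_fps (\<lambda>n. if n = 0 then 0 else real (subgroup_number (hecke_group 5) n)) * m 0"
    unfolding moment_log_deriv[symmetric] moment_deriv left_diff_distrib U by simp
  ultimately have eq: "U 2 - U 1 - 1 = Abs_fps (\<lambda>n. if n = 0 then 0 else real (subgroup_number (hecke_group 5) n))"
    by simp
  show ?thesis
  proof (rule fps_ext)
    fix n
    have "real_of_int ((hecke5_fps 2 - hecke5_fps 1 - 1) $ n) = (U 2 - U 1 - 1) $ n"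
      by (simp add: U_def)
    also have "\<dots> = real_of_int ((fps_X * Abs_fps (\<lambda>n. int (subgroup_number (hecke_group 5) (n + 1)))) $ n)"
      unfolding eq by simp
    finally show "(hecke5_fps 2 - hecke5_fps 1 - 1) $ n = (fps_X * Abs_fps (\<lambda>n. int (subgroup_number (hecke_group 5) (n + 1)))) $ n"
      by linarith
  qed
qed

end

section \<open>Series congruent to polynomials in \<open>\<Phi>\<^sub>2\<close>\<close>

lemma laurent_polynomial_0: "laurent_polynomial 0"
  by (simp add: laurent_polynomial_def)

lemma laurent_polynomial_const: "laurent_polynomial (fls_const c)"
  unfolding laurent_polynomial_def by (rule finite_subset[of _ "{0}"]) auto

lemma laurent_polynomial_of_int: "laurent_polynomial (of_int c :: int fls)"
  by (simp add: fls_of_int laurent_polynomial_const)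

lemma laurent_polynomial_1: "laurent_polynomial (1 :: int fls)"
  using laurent_polynomial_const[of "1::int"] by simp

lemma laurent_polynomial_X_power: "laurent_polynomial (fls_X ^ n :: int fls)"
  by (simp add: laurent_polynomial_def)

lemma laurent_polynomial_X_inv_power: "laurent_polynomial (fls_X_inv ^ n :: int fls)"
  by (simp add: laurent_polynomial_def)

lemma laurent_polynomial_add:
  fixes f g :: "int fls"
  assumes "laurent_polynomial f" "laurent_polynomial g"
  shows "laurent_polynomial (f + g)"
  unfolding laurent_polynomial_def
  by (rule finite_subset[of _ "{k. f $$ k \<noteq> 0} \<union> {k. g $$ k \<noteq> 0}"])
     (use assms in \<open>auto simp: laurent_polynomial_def\<close>)

lemma laurent_polynomial_mult:
  fixes f g :: "int fls"
  assumes "laurent_polynomial f" "laurent_polynomial g"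
  shows "laurent_polynomial (f * g)"
proof -
  have "{k. (f * g) $$ k \<noteq> 0} \<subseteq> (\<lambda>(i, j). i + j) ` ({k. f $$ k \<noteq> 0} \<times> {k. g $$ k \<noteq> 0})"
  proof
    fix k assume "k \<in> {k. (f * g) $$ k \<noteq> 0}"
    then have "(\<Sum>i=fls_subdegree f..k - fls_subdegree g. f $$ i * g $$ (k - i)) \<noteq> 0"
      by (simp add: fls_times_nth(2))
    then obtain i where "f $$ i * g $$ (k - i) \<noteq> 0"
      by (meson sum.not_neutral_contains_not_neutral)
    then show "k \<in> (\<lambda>(i, j). i + j) ` ({k. f $$ k \<noteq> 0} \<times> {k. g $$ k \<noteq> 0})"
      by (intro image_eqI[of _ _ "(i, k - i)"]) auto
  qed
  then show ?thesis
    using assms unfolding laurent_polynomial_def by (meson finite_SigmaI finite_imageI finite_subset)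
qed

lemma laurent_polynomial_sum:
  fixes f :: "'a \<Rightarrow> int fls"
  shows "(\<And>i. i \<in> I \<Longrightarrow> laurent_polynomial (f i)) \<Longrightarrow> laurent_polynomial (sum f I)"
  by (induction I rule: infinite_finite_induct)
     (auto intro: laurent_polynomial_add laurent_polynomial_0)

section \<open>The ring of polynomials in Phi with Laurent polynomial coefficients\<close>

definition laurent_coeffs :: "int fls poly \<Rightarrow> bool" where
  "laurent_coeffs p \<longleftrightarrow> (\<forall>i. laurent_polynomial (coeff p i))"

lemma laurent_coeffs_pCons [simp]:
  "laurent_coeffs (pCons a p) \<longleftrightarrow> laurent_polynomial a \<and> laurent_coeffs p"
  unfolding laurent_coeffs_def by (metis coeff_pCons_0 coeff_pCons_Suc not0_implies_Suc)

lemma laurent_coeffs_0 [simp]: "laurent_coeffs 0"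
  by (simp add: laurent_coeffs_def laurent_polynomial_0)

lemma laurent_coeffs_add: "laurent_coeffs p \<Longrightarrow> laurent_coeffs q \<Longrightarrow> laurent_coeffs (p + q)"
  by (simp add: laurent_coeffs_def laurent_polynomial_add)

lemma laurent_coeffs_mult: "laurent_coeffs p \<Longrightarrow> laurent_coeffs q \<Longrightarrow> laurent_coeffs (p * q)"
  by (simp add: laurent_coeffs_def coeff_mult laurent_polynomial_sum laurent_polynomial_mult)

lemma laurent_coeffs_power: "laurent_coeffs p \<Longrightarrow> laurent_coeffs (p ^ n)"
  by (induction n) (auto simp: laurent_coeffs_mult laurent_polynomial_1 one_pCons)

definition Phi_polys :: "int fls set" where
  "Phi_polys = {poly p Phi2 | p. laurent_coeffs p}"

lemma Phi_polysI: "laurent_coeffs p \<Longrightarrow> poly p Phi2 \<in> Phi_polys"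
  by (auto simp: Phi_polys_def)

lemma Phi_polys_add: "x \<in> Phi_polys \<Longrightarrow> y \<in> Phi_polys \<Longrightarrow> x + y \<in> Phi_polys"
  unfolding Phi_polys_def by clarify (metis laurent_coeffs_add poly_add)

lemma Phi_polys_mult: "x \<in> Phi_polys \<Longrightarrow> y \<in> Phi_polys \<Longrightarrow> x * y \<in> Phi_polys"
  unfolding Phi_polys_def by clarify (metis laurent_coeffs_mult poly_mult)

lemma laurent_polynomial_in_Phi_polys: "laurent_polynomial a \<Longrightarrow> a \<in> Phi_polys"
  using Phi_polysI[of "[:a:]"] by simp

lemma Phi2_in_Phi_polys: "Phi2 \<in> Phi_polys"
  using Phi_polysI[of "[:0, 1:]"] by (simp add: laurent_polynomial_0 laurent_polynomial_1)

lemma Phi_polys_of_int: "of_int c \<in> Phi_polys"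
  by (intro laurent_polynomial_in_Phi_polys laurent_polynomial_of_int)

lemma Phi_polys_uminus: "x \<in> Phi_polys \<Longrightarrow> - x \<in> Phi_polys"
  using Phi_polys_mult[OF Phi_polys_of_int[of "-1"], of x] by simp

section \<open>Rings of series congruent to such polynomials modulo 2^m\<close>

definition Phi_approx :: "nat \<Rightarrow> int fls set" where
  "Phi_approx m = {x. \<exists>a\<in>Phi_polys. 2 ^ m dvd x - a}"

lemma Phi_approxE:
  assumes "x \<in> Phi_approx m"
  obtains a w where "a \<in> Phi_polys" "x = a + 2 ^ m * w"
  using assms unfolding Phi_approx_def dvd_def by (auto simp: algebra_simps)

lemma Phi_approxI: "a \<in> Phi_polys \<Longrightarrow> 2 ^ m dvd x - a \<Longrightarrow> x \<in> Phi_approx m"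
  by (auto simp: Phi_approx_def)

lemma Phi_polys_in_Phi_approx: "a \<in> Phi_polys \<Longrightarrow> a \<in> Phi_approx m"
  by (rule Phi_approxI[of a]) auto

lemma Phi_approx_cong: "x \<in> Phi_approx m \<Longrightarrow> 2 ^ m dvd y - x \<Longrightarrow> y \<in> Phi_approx m"
proof -
  assume "x \<in> Phi_approx m" and y: "2 ^ m dvd y - x"
  then obtain a where a: "a \<in> Phi_polys" "2 ^ m dvd x - a" by (auto simp: Phi_approx_def)
  have "2 ^ m dvd (y - x) + (x - a)" using y a(2) by (rule dvd_add)
  then show ?thesis using a(1) by (intro Phi_approxI[of a]) simp_all
qed

lemma Phi_approx_add: "x \<in> Phi_approx m \<Longrightarrow> y \<in> Phi_approx m \<Longrightarrow> x + y \<in> Phi_approx m"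
proof -
  assume "x \<in> Phi_approx m" "y \<in> Phi_approx m"
  then obtain a b v w where "a \<in> Phi_polys" "x = a + 2 ^ m * v" "b \<in> Phi_polys" "y = b + 2 ^ m * w"
    by (meson Phi_approxE)
  moreover have "2 ^ m * (v + w) = x + y - (a + b)" using calculation by (simp add: algebra_simps)
  ultimately show ?thesis by (metis Phi_approxI Phi_polys_add dvd_triv_left)
qed

lemma Phi_approx_mult: "x \<in> Phi_approx m \<Longrightarrow> y \<in> Phi_approx m \<Longrightarrow> x * y \<in> Phi_approx m"
proof -
  assume "x \<in> Phi_approx m" "y \<in> Phi_approx m"
  then obtain a b v w where *: "a \<in> Phi_polys" "x = a + 2 ^ m * v" "b \<in> Phi_polys" "y = b + 2 ^ m * w"
    by (meson Phi_approxE)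
  have "x * y - a * b = 2 ^ m * (v * b + w * a + 2 ^ m * v * w)"
    unfolding * by (simp add: algebra_simps)
  then show ?thesis using * by (metis Phi_approxI Phi_polys_mult dvd_triv_left)
qed

lemma Phi_approx_of_int: "of_int c \<in> Phi_approx m"
  by (intro Phi_polys_in_Phi_approx Phi_polys_of_int)

lemma Phi_approx_X_power: "fls_X ^ n \<in> Phi_approx m"
  by (intro Phi_polys_in_Phi_approx laurent_polynomial_in_Phi_polys laurent_polynomial_X_power)

lemma Phi_approx_X_inv_power: "fls_X_inv ^ n \<in> Phi_approx m"
  by (intro Phi_polys_in_Phi_approx laurent_polynomial_in_Phi_polys laurent_polynomial_X_inv_power)

lemma Phi_approx_uminus: "x \<in> Phi_approx m \<Longrightarrow> - x \<in> Phi_approx m"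
  using Phi_approx_mult[OF Phi_approx_of_int[of "-1"], of x] by simp

lemma Phi_approx_diff: "x \<in> Phi_approx m \<Longrightarrow> y \<in> Phi_approx m \<Longrightarrow> x - y \<in> Phi_approx m"
  using Phi_approx_add[OF _ Phi_approx_uminus, of x _ y] by simp

lemma Phi_approx_power: "x \<in> Phi_approx m \<Longrightarrow> x ^ n \<in> Phi_approx m"
  by (induction n) (use Phi_approx_of_int[of 1] in \<open>auto simp: Phi_approx_mult\<close>)

lemmas Phi_approx_closed = Phi_approx_add Phi_approx_diff Phi_approx_uminus Phi_approx_mult
  Phi_approx_power Phi_approx_of_int Phi_approx_X_power Phi_approx_X_inv_power

lemma Phi_approx_double: "x \<in> Phi_approx m \<Longrightarrow> 2 * x \<in> Phi_approx (Suc m)"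
proof -
  assume "x \<in> Phi_approx m"
  then obtain a w where *: "a \<in> Phi_polys" "x = a + 2 ^ m * w" by (rule Phi_approxE)
  show ?thesis
    by (rule Phi_approxI[of "2 * a"])
       (use * Phi_polys_mult[OF Phi_polys_of_int[of 2]] in \<open>auto simp: algebra_simps\<close>)
qed

text \<open>In (a + 2^m w)^2 the cross term gains a factor 2, and 2^(2m) is divisible by 2^(m+1)
  because m is at least 1.\<close>

lemma Phi_approx_square:
  assumes "x \<in> Phi_approx m" "m \<ge> 1"
  shows "x\<^sup>2 \<in> Phi_approx (Suc m)"
proof -
  obtain a w where *: "a \<in> Phi_polys" "x = a + 2 ^ m * w" using assms(1) by (rule Phi_approxE)
  obtain l where l: "m = Suc l" using assms(2) by (cases m) auto
  have "x\<^sup>2 - a\<^sup>2 = 2 ^ Suc m * (a * w + 2 ^ l * w\<^sup>2)"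
    unfolding * l by (simp add: power2_eq_square algebra_simps)
  then show ?thesis using * by (metis Phi_approxI Phi_polys_mult dvd_triv_left power2_eq_square)
qed

section \<open>Frobenius modulo 2 and the equations of Phi and of
  \<open>hecke5_fls 2\<close>\<close>

lemma even_square_nth:
  fixes f :: "int fps"
  shows "even ((f\<^sup>2) $ n - (if even n then f $ (n div 2) else 0))"
proof -
  \<comment> \<open>The terms i and n - i of the convolution coincide, so modulo 2 only a middle
    term survives, and a square has the parity of its base.\<close>
  let ?g = "\<lambda>i. f $ i * f $ (n - i)"
  let ?A = "{i. 2 * i < n}" and ?B = "{i. 2 * i = n}" and ?C = "{i. i \<le> n \<and> 2 * i > n}"
  have fin: "finite ?A" "finite ?B" "finite ?C"
    by (rule finite_subset[of _ "{..n}"]; auto)+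
  have "(f\<^sup>2) $ n = sum ?g (?A \<union> ?B \<union> ?C)"
    unfolding power2_eq_square fps_mult_nth by (rule sum.cong) auto
  also have "\<dots> = sum ?g ?A + sum ?g ?B + sum ?g ?C"
    using fin by (subst sum.union_disjoint; auto simp: sum.union_disjoint)+
  also have "sum ?g ?C = sum ?g ?A"
    by (rule sum.reindex_bij_witness[of _ "\<lambda>i. n - i" "\<lambda>i. n - i"]) auto
  also have "sum ?g ?B = (if even n then (f $ (n div 2))\<^sup>2 else 0)"
  proof (cases "even n")
    case True
    then have "?B = {n div 2}" "n - n div 2 = n div 2" by auto
    then show ?thesis using True by (simp add: power2_eq_square)
  next
    case False
    then have "?B = {}" by auto
    then show ?thesis using False by simp
  qed
  finally show ?thesis by auto
qed

lemma even_power4_nth: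
  fixes f :: "int fps"
  shows "even ((f ^ 4) $ n - (if 4 dvd n then f $ (n div 4) else 0))"
proof -
  have "f ^ 4 = (f\<^sup>2)\<^sup>2" by simp
  moreover have "4 dvd n \<longleftrightarrow> even n \<and> even (n div 2)" "n div 2 div 2 = n div 4"
    by presburger+
  ultimately show ?thesis
    using even_square_nth[of "f\<^sup>2" n] even_square_nth[of f "n div 2"]
    by (auto split: if_splits)
qed

lemma two_dvd_fps_to_fls:
  assumes "\<And>n. even (f $ n)"
  shows "2 dvd (fps_to_fls f :: int fls)"
proof -
  have "of_int 2 dvd f" using assms by (intro fps_of_int_dvdI)
  then obtain w where "f = 2 * w" by (auto simp: dvd_def)
  then show ?thesis by (simp add: fls_times_fps_to_fls)
qed

lemma even_nth_if_two_dvd: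
  assumes "2 dvd (fps_to_fls f :: int fls)"
  shows "even (f $ n)"
proof -
  obtain w where "fps_to_fls f = fls_const 2 * w" using assms by (auto simp: dvd_def)
  then have "fps_to_fls f $$ int n = 2 * w $$ int n" by simp
  then show ?thesis by simp
qed

text \<open>Modulo 2 the fourth power substitutes \<open>fls_X ^ 4\<close> for \<open>fls_X\<close>,
  which raises every exponent 4^n to 4^(n+1) and so loses just the first summand
  \<open>fls_X\<close>.\<close>

lemma Phi2_power4: "2 dvd Phi2 ^ 4 - (Phi2 - fls_X)"
proof -
  define P :: "int fps" where "P = Abs_fps (\<lambda>k. if \<exists>n::nat. k = 4 ^ n then 1 else 0)"
  have "even ((P ^ 4 - (P - fps_X)) $ k)" for k
  proof -
    have "(\<exists>n. k = 4 ^ n) \<and> k \<noteq> 1 \<longleftrightarrow> 4 dvd k \<and> (\<exists>n. k div 4 = 4 ^ n)"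
    proof safe
      fix n assume "(4::nat) ^ n \<noteq> 1"
      then obtain i where "n = Suc i" by (cases n) auto
      then show "4 dvd (4::nat) ^ n" "\<exists>i. (4::nat) ^ n div 4 = 4 ^ i" by auto
    next
      fix n assume "4 dvd k" "k div 4 = 4 ^ n"
      then have "k = 4 ^ Suc n" by auto
      then show "\<exists>n. k = 4 ^ n" by blast
    qed auto
    moreover have "\<exists>n::nat. (1::nat) = 4 ^ n" by (rule exI[of _ 0]) simp
    ultimately have "(P - fps_X) $ k = (if 4 dvd k then P $ (k div 4) else 0)"
      unfolding P_def by auto
    then show ?thesis using even_power4_nth[of P k] by simp
  qed
  moreover have "fps_to_fls (P ^ 4 - (P - fps_X)) = Phi2 ^ 4 - (Phi2 - fls_X)"
    by (simp add: Phi2_def P_def fps_to_fls_power)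
  ultimately show ?thesis by (metis two_dvd_fps_to_fls)
qed

lemma two_dvd_diff_power4: "2 dvd (a - b) ^ 4 - (a ^ 4 - b ^ 4)" for a b :: "'a::comm_ring_1"
proof -
  have "(a - b) ^ 4 - (a ^ 4 - b ^ 4) = 2 * (b ^ 4 - 2 * a ^ 3 * b + 3 * a\<^sup>2 * b\<^sup>2 - 2 * a * b ^ 3)"
    by (simp add: eval_nat_numeral algebra_simps)
  then show ?thesis by (metis dvd_triv_left)
qed

text \<open>In the n-th coefficient of \<open>y * y ^ 3\<close>, the terms with i < n are even by
  induction, and the term i = n carries the vanishing constant coefficient of
  \<open>y ^ 3\<close>.\<close>

lemma even_nth_of_power4_fixpoint:
  fixes y :: "int fps"
  assumes y: "2 dvd y - y ^ 4" and "y $ 0 = 0"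
  shows "even (y $ n)"
proof (induction n rule: less_induct)
  case (less n)
  obtain w where w: "y = y ^ 4 + 2 * w" using y by (auto simp: dvd_def algebra_simps)
  have "even ((y * y ^ 3) $ n)"
    unfolding fps_mult_nth
  proof (rule dvd_sum)
    fix i assume "i \<in> {0..n}"
    then show "even (y $ i * (y ^ 3) $ (n - i))"
      using less[of i] assms(2) by (cases "i = n") (auto simp: fps_power_zeroth)
  qed
  then show ?case
    using arg_cong[OF w, of "\<lambda>f. f $ n"] by (simp add: eval_nat_numeral numeral_fps_const)
qed

lemma hecke5_fls_fps: "hecke5_fls j = fps_to_fls (hecke5_fps j oo fps_X ^ 3)"
  by (simp add: hecke5_fls_def fls_compose_power_fps_to_fls)

text \<open>Both series satisfy h = h^4 - X^16 modulo 2, so their difference is fixed by the fourth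
  power and vanishes modulo 2. The factor X^10 is chosen so that X^10 X^30 = (X^10)^4 turns the
  relation between entries 8 and 2 into one for h alone.\<close>

lemma two_dvd_hecke5_fls_2: "2 dvd fls_X ^ 10 * hecke5_fls 2 - (Phi2 - fls_X - fls_X ^ 4)"
proof -
  define h where "h = fls_X ^ 10 * hecke5_fls 2"
  define g where "g = Phi2 - fls_X - fls_X ^ 4"
  have h: "2 dvd h - (h ^ 4 - fls_X ^ 16)"
  proof -
    \<comment> \<open>Shifting by 2 and by 4 shows that entry 8 is congruent to the fourth power of
      entry 2.\<close>
    have "2 dvd hecke5_fls (2 + 2) - hecke5_fls 2 * hecke5_fls 2"
      "2 dvd hecke5_fls (4 + 4) - hecke5_fls 4 * hecke5_fls 4"
      using hecke5_fls_shift[of 1 2 2] hecke5_fls_shift[of 1 4 4] by simp_all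
    then obtain v w where v: "hecke5_fls 4 = (hecke5_fls 2)\<^sup>2 + 2 * v" and w: "hecke5_fls 8 = (hecke5_fls 4)\<^sup>2 + 2 * w"
      by (auto simp: dvd_def algebra_simps power2_eq_square)
    obtain r where r: "fls_X ^ 30 * hecke5_fls 8 = hecke5_fls 2 + fls_X ^ 6 + 2 * r"
      using hecke5_fls_even_step[of 0] that by (simp only: mult_0_right add_0 hecke5_fls_0 mult_1_right)
    have X: "(fls_X :: int fls) ^ 10 * fls_X ^ 30 = (fls_X ^ 10) ^ 4" "(fls_X :: int fls) ^ 10 * fls_X ^ 6 = fls_X ^ 16"
      by (simp_all flip: power_add power_mult)
    have "h + fls_X ^ 16 + 2 * (fls_X ^ 10 * r) = fls_X ^ 10 * (fls_X ^ 30 * hecke5_fls 8)"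
      unfolding r h_def X[symmetric] by (simp add: algebra_simps)
    also have "\<dots> = h ^ 4 + 2 * (fls_X ^ 10 * fls_X ^ 30 * (2 * v * (hecke5_fls 2)\<^sup>2 + 2 * v\<^sup>2 + w))"
      unfolding mult.assoc[symmetric] X h_def w v
      by (simp add: algebra_simps eval_nat_numeral)
    finally have "h - (h ^ 4 - fls_X ^ 16) =
        2 * (fls_X ^ 10 * fls_X ^ 30 * (2 * v * (hecke5_fls 2)\<^sup>2 + 2 * v\<^sup>2 + w) - fls_X ^ 10 * r)"
      by (simp add: algebra_simps)
    then show ?thesis by simp
  qed
  \<comment> \<open>Modulo 2, g^4 = Phi^4 - X^4 - X^16 = g - X^16, and the sign of X^16 is
    irrelevant.\<close>
  have g: "2 dvd g - (g ^ 4 - fls_X ^ 16)"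
  proof -
    obtain v where v: "Phi2 ^ 4 = Phi2 - fls_X + 2 * v"
      using Phi2_power4 by (auto simp: dvd_def algebra_simps)
    obtain w where w: "g ^ 4 = (Phi2 - fls_X) ^ 4 - (fls_X ^ 4) ^ 4 + 2 * w"
      using two_dvd_diff_power4[of "Phi2 - fls_X" "fls_X ^ 4"] unfolding g_def
      by (auto simp: dvd_def algebra_simps)
    obtain r where r: "(Phi2 - fls_X) ^ 4 = Phi2 ^ 4 - fls_X ^ 4 + 2 * r"
      using two_dvd_diff_power4[of "Phi2" "fls_X"] by (auto simp: dvd_def algebra_simps)
    have "g - (g ^ 4 - fls_X ^ 16) = 2 * (fls_X ^ 16 - v - w - r)"
      unfolding w r v by (simp add: g_def algebra_simps flip: power_mult)
    then show ?thesis by (metis dvd_triv_left)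
  qed
  \<comment> \<open>The difference h - g as a power series, whose constant coefficient is 0.\<close>
  define y where "y = fps_X ^ 10 * (hecke5_fps 2 oo fps_X ^ 3)
      - (Abs_fps (\<lambda>k. if \<exists>n::nat. k = 4 ^ n then 1 else 0) - fps_X - fps_X ^ 4)"
  have y: "fps_to_fls y = h - g"
    by (simp add: y_def h_def g_def Phi2_def hecke5_fls_fps fls_times_fps_to_fls fps_to_fls_power)
  obtain v where v: "h - g = h ^ 4 - g ^ 4 + 2 * v"
    using dvd_diff[OF h g] by (auto simp: dvd_def algebra_simps)
  obtain w where w: "(h - g) ^ 4 = h ^ 4 - g ^ 4 + 2 * w"
    using two_dvd_diff_power4[of h g] by (auto simp: dvd_def algebra_simps)
  have "(h - g) - (h - g) ^ 4 = (h ^ 4 - g ^ 4 + 2 * v) - (h ^ 4 - g ^ 4 + 2 * w)"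
    by (rule arg_cong2[of _ _ _ _ "(-)", OF v w])
  also have "\<dots> = 2 * (v - w)" by (simp add: algebra_simps)
  finally have "(h - g) - (h - g) ^ 4 = 2 * (v - w)" .
  then have "2 dvd (fps_to_fls (y - y ^ 4) :: int fls)"
    by (simp add: y fps_to_fls_power)
  then have "even ((y - y ^ 4) $ n)" for n
    by (rule even_nth_if_two_dvd)
  then have "of_int 2 dvd y - y ^ 4" by (rule fps_of_int_dvdI)
  moreover have "y $ 0 = 0" by (simp add: y_def fps_X_power_mult_nth)
  ultimately have "even (y $ n)" for n by (intro even_nth_of_power4_fixpoint) auto
  then show ?thesis using two_dvd_fps_to_fls[of y] by (simp add: y h_def g_def)
qed

section \<open>Induction on the exponent of 2\<close>

lemma X_inv_power_mult_X_power: "fls_X_inv ^ n * fls_X ^ n = (1 :: int fls)"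
  by (simp add: fls_X_inv_power_times_conv_shift fls_X_power_conv_shift_1)

text \<open>In the system at j = 2i, the only odd-indexed entry on the right has the even factor 2i,
  so doubles of odd entries suffice.\<close>

lemma hecke5_fls_in_Phi_approx_if_even:
  assumes "\<And>i. hecke5_fls (2 * i) \<in> Phi_approx m" "\<And>j. 2 * hecke5_fls j \<in> Phi_approx m"
  shows "hecke5_fls j \<in> Phi_approx m"
proof (cases "even j")
  case False
  then obtain i where j: "j = Suc (2 * i)" by (auto elim: oddE)
  have i: "2 * (i + 2) = 2 * i + 4" by simp
  have "hecke5_fls j = (of_int 1 + fls_X ^ 3) * hecke5_fls (2 * i)
      + of_int (int i) * (2 * hecke5_fls (2 * i - 1)) + fls_X ^ 15 * hecke5_fls (2 * (i + 2))"
    using hecke5_fls_Suc[of "2 * i"] unfolding i j by (simp add: mult_ac)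
  also have "\<dots> \<in> Phi_approx m" by (intro assms Phi_approx_closed)
  finally show ?thesis .
qed (use assms in auto)

text \<open>Entry 2 is known modulo 2, and shifting by 2 makes every even entry congruent to a power
  of it.\<close>

lemma hecke5_fls_in_Phi_approx_1: "hecke5_fls j \<in> Phi_approx 1"
proof (rule hecke5_fls_in_Phi_approx_if_even)
  show "2 * hecke5_fls j \<in> Phi_approx 1" for j
    using Phi_approxI[of 0] Phi_polys_of_int[of 0] by simp
  have "fls_X_inv ^ 10 * (Phi2 - fls_X ^ 1 - fls_X ^ 4) \<in> Phi_approx 1"
    by (intro Phi_approx_closed Phi_polys_in_Phi_approx Phi2_in_Phi_polys)
  moreover obtain w where "fls_X ^ 10 * hecke5_fls 2 = Phi2 - fls_X - fls_X ^ 4 + 2 * w"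
    using two_dvd_hecke5_fls_2 by (auto simp: dvd_def algebra_simps)
  then have "fls_X_inv ^ 10 * fls_X ^ 10 * hecke5_fls 2 = fls_X_inv ^ 10 * (Phi2 - fls_X - fls_X ^ 4 + 2 * w)"
    by (simp add: mult.assoc)
  then have "hecke5_fls 2 = fls_X_inv ^ 10 * (Phi2 - fls_X - fls_X ^ 4 + 2 * w)"
    by (simp add: X_inv_power_mult_X_power)
  then have "hecke5_fls 2 - fls_X_inv ^ 10 * (Phi2 - fls_X ^ 1 - fls_X ^ 4) = 2 ^ 1 * (fls_X_inv ^ 10 * w)"
    by (simp add: algebra_simps)
  then have "2 ^ 1 dvd hecke5_fls 2 - fls_X_inv ^ 10 * (Phi2 - fls_X ^ 1 - fls_X ^ 4)" by simp
  ultimately have 2: "hecke5_fls 2 \<in> Phi_approx 1" by (rule Phi_approx_cong)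
  show "hecke5_fls (2 * i) \<in> Phi_approx 1" for i
  proof (induction i)
    case 0
    then show ?case using Phi_approx_of_int[of 1] by (simp add: hecke5_fls_0)
  next
    case (Suc i)
    then show ?case
      using Phi_approx_cong[OF Phi_approx_mult[OF 2 Suc] hecke5_fls_shift[of 1 2 "2 * i"]] by simp
  qed
qed

lemma hecke5_fls_in_Phi_approx_Suc:
  assumes m: "m \<ge> 1" and IH: "\<And>j. hecke5_fls j \<in> Phi_approx m"
  shows "hecke5_fls j \<in> Phi_approx (Suc m)"
proof (rule hecke5_fls_in_Phi_approx_if_even)
  let ?N = "Phi_approx (Suc m)"
  define x where "x = (\<lambda>i. hecke5_fls (2 * i))"
  have x_m: "x i \<in> Phi_approx m" for i by (simp add: x_def IH)
  have x0: "x 0 = 1" by (simp add: x_def hecke5_fls_0)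
  \<comment> \<open>With T the shift of the index, the relation T = a + b T^4 modulo
    \<open>?N\<close> is squared repeatedly to reach T^(2^e).\<close>
  have power2: "\<exists>a\<in>Phi_polys. \<exists>b\<in>Phi_polys. \<forall>i. x (i + 2 ^ e) - (a * x i + b * x (i + 4 * 2 ^ e)) \<in> ?N"
    for e
  proof (induction e)
    case 0
    have "x (i + 2 ^ 0) - ((- (fls_X ^ 6)) * x i + fls_X ^ 30 * x (i + 4 * 2 ^ 0)) \<in> ?N" for i
    proof -
      let ?y = "(fls_X ^ 3 - of_int (int i)) * hecke5_fls (2 * i) - (of_int 1 + fls_X ^ 3) * hecke5_fls (2 * i + 1)
           + of_int (int i) * (of_int 1 + fls_X ^ 3) * hecke5_fls (2 * i - 1)
           - of_int (int (i + 2)) * fls_X ^ 15 * hecke5_fls (2 * i + 3)"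
      have "?y \<in> Phi_approx m" by (intro Phi_approx_closed IH)
      then have "- (2 * ?y) \<in> ?N" by (intro Phi_approx_uminus Phi_approx_double)
      moreover have "2 * (i + 4) = 2 * i + 8" "2 * (i + 1) = 2 * i + 2" by simp_all
      then have "x (i + 2 ^ 0) - ((- (fls_X ^ 6)) * x i + fls_X ^ 30 * x (i + 4 * 2 ^ 0)) = - (2 * ?y)"
        unfolding x_def using hecke5_fls_even_step[of i] by simp
      ultimately show ?thesis by simp
    qed
    then show ?case
      by (intro bexI[of _ "- (fls_X ^ 6)"] bexI[of _ "fls_X ^ 30"] allI Phi_polys_uminus
          laurent_polynomial_in_Phi_polys laurent_polynomial_X_power)
  next
    case (Suc e)
    then obtain a b where a: "a \<in> Phi_polys" and b: "b \<in> Phi_polys"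
      and ab: "\<And>i. x (i + 2 ^ e) - (a * x i + b * x (i + 4 * 2 ^ e)) \<in> ?N" by blast
    have "x (i + 2 ^ Suc e) - (a\<^sup>2 * x i + b\<^sup>2 * x (i + 4 * 2 ^ Suc e)) \<in> ?N" for i
    proof -
      define k :: nat where "k = 2 ^ e"
      let ?d = "\<lambda>i. x (i + k) - (a * x i + b * x (i + 4 * k))"
      have d: "?d i \<in> ?N" for i using ab[of i] by (simp add: k_def)
      have abx: "a * b * x (i + 4 * k) \<in> Phi_approx m"
        using a b by (intro Phi_approx_mult Phi_polys_in_Phi_approx x_m)
      \<comment> \<open>This is T^k + a + b T^(4k) applied to the relation, plus the cross term 2ab
        T^(4k), which lies in \<open>?N\<close> as the double of something known modulo 2^m.\<close>
      have "?d (i + k) + a * ?d i + b * ?d (i + 4 * k) + 2 * (a * b * x (i + 4 * k)) \<in> ?N"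
        by (intro Phi_approx_add Phi_approx_double[OF abx] Phi_approx_mult d a b Phi_polys_in_Phi_approx)
      moreover have "?d (i + k) + a * ?d i + b * ?d (i + 4 * k) + 2 * (a * b * x (i + 4 * k))
          = x (i + 2 * k) - (a\<^sup>2 * x i + b\<^sup>2 * x (i + 8 * k))"
        by (simp add: algebra_simps power2_eq_square mult_2_right)
      ultimately show ?thesis by (simp add: k_def)
    qed
    then show ?case using a b Phi_polys_mult unfolding power2_eq_square by blast
  qed
  \<comment> \<open>Starting from the trivial relation p = 0, r = 1, each step replaces
    \<open>x (i + 4 ^ s)\<close> by means of \<open>power2\<close> with exponent 2s.\<close>
  have succ: "\<exists>p\<in>Phi_polys. \<exists>r\<in>Phi_polys. \<forall>i. x (i + 1) - (p * x i + r * x (i + 4 ^ s)) \<in> ?N" for s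
  proof (induction s)
    case 0
    show ?case
      by (rule bexI[of _ "of_int 0"], rule bexI[of _ "of_int 1"])
         (use Phi_approx_of_int[of 0] in simp, rule Phi_polys_of_int, rule Phi_polys_of_int)
  next
    case (Suc s)
    then obtain p r where p: "p \<in> Phi_polys" and r: "r \<in> Phi_polys"
      and pr: "\<And>i. x (i + 1) - (p * x i + r * x (i + 4 ^ s)) \<in> ?N" by blast
    have s4: "2 ^ (2 * s) = (4 ^ s :: nat)" by (simp add: power_mult)
    obtain a b where a: "a \<in> Phi_polys" and b: "b \<in> Phi_polys"
      and ab: "\<And>i. x (i + 4 ^ s) - (a * x i + b * x (i + 4 * 4 ^ s)) \<in> ?N"
      using power2[of "2 * s"] unfolding s4 by blast
    have "x (i + 1) - ((p + r * a) * x i + r * b * x (i + 4 ^ Suc s)) \<in> ?N" for i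
    proof -
      have "x (i + 1) - (p * x i + r * x (i + 4 ^ s))
          + r * (x (i + 4 ^ s) - (a * x i + b * x (i + 4 * 4 ^ s))) \<in> ?N"
        using pr ab r by (intro Phi_approx_add Phi_approx_mult) (auto simp: Phi_polys_in_Phi_approx)
      then show ?thesis by (simp add: algebra_simps)
    qed
    then show ?case using p r a b Phi_polys_mult Phi_polys_add by blast
  qed
  define Q :: nat where "Q = 4 ^ m"
  \<comment> \<open>As \<open>x\<close> uses doubled indices, shifting it by \<open>Q\<close> shifts
    \<open>hecke5_fls\<close> by a multiple of 2^(m+1), so \<open>shift\<close> holds at the higher
    precision.\<close>
  have "2 ^ m dvd Q" by (simp add: Q_def dvd_power_same)
  then have "2 ^ Suc m dvd 2 * (2 * Q)" "2 ^ Suc m dvd 2 * Q"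
    by auto
  then have shift: "2 ^ Suc m dvd x (i + Q) - x Q * x i" "2 ^ Suc m dvd x (i + 2 * Q) - x (2 * Q) * x i" for i
    using hecke5_fls_shift[of "Suc m" "2 * Q" "2 * i"] hecke5_fls_shift[of "Suc m" "2 * (2 * Q)" "2 * i"]
    unfolding x_def distrib_left by simp_all
  \<comment> \<open>Modulo 2^(m+1) this is the square of \<open>x (2 * Q)\<close>, and squaring
    gains a factor 2. The relation at i = 0, where \<open>x 0 = 1\<close>, then yields
    \<open>x Q\<close>.\<close>
  have "x (4 * Q) \<in> ?N"
    using Phi_approx_cong[OF Phi_approx_square[OF x_m m, of "2 * Q"]] shift(2)[of "2 * Q"]
    by (simp add: power2_eq_square)
  moreover obtain a b where "a \<in> Phi_polys" "b \<in> Phi_polys"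
    and ab: "\<And>i. x (i + Q) - (a * x i + b * x (i + 4 * Q)) \<in> ?N"
    using power2[of "2 * m"] unfolding Q_def power_mult by auto
  ultimately have "a + b * x (4 * Q) \<in> ?N"
    by (intro Phi_approx_add Phi_approx_mult Phi_polys_in_Phi_approx[of a] Phi_polys_in_Phi_approx[of b])
  then have "x (0 + Q) - (a * x 0 + b * x (0 + 4 * Q)) + (a + b * x (4 * Q)) \<in> ?N"
    by (rule Phi_approx_add[OF ab])
  then have xQ: "x Q \<in> ?N" by (simp add: x0)
  obtain p r where p: "p \<in> Phi_polys" and r: "r \<in> Phi_polys"
    and pr: "\<And>i. x (i + 1) - (p * x i + r * x (i + Q)) \<in> ?N" using succ[of m] unfolding Q_def by blast
  have "x i \<in> ?N" for i
  proof (induction i)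
    case 0
    then show ?case using Phi_approx_of_int[of 1] by (simp add: x0)
  next
    case (Suc i)
    have "x (i + Q) \<in> ?N" using Phi_approx_cong[OF Phi_approx_mult[OF xQ Suc] shift(1)] .
    then have "p * x i + r * x (i + Q) \<in> ?N"
      using Suc p r
      by (intro Phi_approx_add Phi_approx_mult Phi_polys_in_Phi_approx[of p] Phi_polys_in_Phi_approx[of r])
    then have "x (i + 1) - (p * x i + r * x (i + Q)) + (p * x i + r * x (i + Q)) \<in> ?N"
      by (rule Phi_approx_add[OF pr])
    then show ?case by simp
  qed
  then show "hecke5_fls (2 * i) \<in> ?N" for i by (simp add: x_def)
  show "2 * hecke5_fls j \<in> ?N" for j by (rule Phi_approx_double[OF IH])
qed

lemma hecke5_fls_in_Phi_approx: "m \<ge> 1 \<Longrightarrow> hecke5_fls j \<in> Phi_approx m"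
  by (induction m arbitrary: j rule: nat_induct_at_least)
     (use hecke5_fls_in_Phi_approx_1 hecke5_fls_in_Phi_approx_Suc in blast)+

section \<open>Reduction of the degree\<close>

lemma Phi_polys_degree_reduce:
  assumes K: "K \<ge> 1" and p: "laurent_coeffs p"
  shows "\<exists>q. degree q < 4 * K \<and> laurent_coeffs q \<and> 2 ^ K dvd poly p Phi2 - poly q Phi2"
proof -
  \<comment> \<open>By \<open>Phi2_power4\<close> the value of V at \<open>Phi2\<close> is even, so
    \<open>W\<close> is a monic polynomial of degree 4K whose value is divisible by 2^K.\<close>
  define V :: "int fls poly" where "V = [:fls_X, - 1, 0, 0, 1:]"
  define W where "W = V ^ K"
  have "laurent_polynomial (- 1 :: int fls)" using laurent_polynomial_of_int[of "-1"] by simp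
  then have W: "laurent_coeffs W"
    using laurent_polynomial_X_power[of 1]
    unfolding W_def V_def
    by (intro laurent_coeffs_power) (simp add: laurent_polynomial_0 laurent_polynomial_1)
  have "V \<noteq> 0" "degree V = 4" "lead_coeff V = 1" by (simp_all add: V_def)
  then have deg_W: "degree W = 4 * K" and "lead_coeff W = 1"
    unfolding W_def lead_coeff_power by (simp_all add: degree_power_eq)
  have "poly V Phi2 = Phi2 ^ 4 - (Phi2 - fls_X)"
    by (simp add: V_def eval_nat_numeral algebra_simps)
  then have W_dvd: "2 ^ K dvd poly W Phi2"
    using Phi2_power4 by (simp add: W_def dvd_power_same)
  show ?thesis
    using p
  proof (induction p)
    case 0
    then show ?case using K by (intro exI[of _ 0]) simp
  next
    case (pCons a p)
    then obtain q where q: "degree q < 4 * K" "laurent_coeffs q" "2 ^ K dvd poly p Phi2 - poly q Phi2"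
      by auto
    \<comment> \<open>The coefficient of \<open>q\<close> at 4K - 1 becomes the one at 4K after
      multiplication by the variable; subtracting \<open>c\<close> times the monic \<open>W\<close>
      cancels it.\<close>
    define c where "c = coeff q (4 * K - 1)"
    define r where "r = pCons a q - smult c W"
    have "r = pCons a q + [:- c:] * W" by (simp add: r_def)
    moreover have "laurent_polynomial (- c)"
      using q(2) laurent_polynomial_mult[OF laurent_polynomial_of_int[of "-1"], of c]
      by (simp add: c_def laurent_coeffs_def)
    ultimately have "laurent_coeffs r"
      using pCons.prems q(2) W
      by (auto intro!: laurent_coeffs_add laurent_coeffs_mult simp del: mult_pCons_left)
    moreover have "degree r < 4 * K"
    proof -
      have "degree (pCons a q) \<le> 4 * K" using q(1) by (intro order.trans[OF degree_pCons_le]) simp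
      moreover have "degree (smult c W) \<le> 4 * K" using degree_smult_le[of c W] deg_W by simp
      ultimately have "degree r \<le> 4 * K" unfolding r_def by (rule degree_diff_le)
      moreover have "coeff r (4 * K) = 0"
        using K \<open>lead_coeff W = 1\<close> deg_W by (simp add: r_def c_def coeff_pCons split: nat.splits)
      ultimately have "degree r \<noteq> 4 * K \<or> r = 0" by (metis leading_coeff_0_iff)
      then show ?thesis using \<open>degree r \<le> 4 * K\<close> K by auto
    qed
    moreover have "poly (pCons a p) Phi2 - poly r Phi2 = Phi2 * (poly p Phi2 - poly q Phi2) + c * poly W Phi2"
      by (simp add: r_def algebra_simps)
    then have "2 ^ K dvd poly (pCons a p) Phi2 - poly r Phi2"
      using q(3) W_dvd by (simp add: dvd_add dvd_mult)
    ultimately show ?case by blast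
  qed
qed

lemma fls_cong_if_dvd:
  assumes "of_int M dvd f - g"
  shows "fls_cong f g M"
proof -
  obtain w where w: "f = g + fls_const M * w"
    using assms by (auto simp: dvd_def fls_of_int algebra_simps)
  show ?thesis
    by (simp add: fls_cong_def w cong_def)
qed

lemma Phi_approx_poly:
  assumes "K \<ge> 1" "x \<in> Phi_approx K"
  shows "\<exists>p. degree p < 4 * K \<and> (\<forall>i. laurent_polynomial (coeff p i)) \<and> fls_cong x (poly p Phi2) (2 ^ K)"
proof -
  obtain p where p: "laurent_coeffs p" "2 ^ K dvd x - poly p Phi2"
    using assms(2) by (auto simp: Phi_approx_def Phi_polys_def)
  obtain q where q: "degree q < 4 * K" "laurent_coeffs q" "2 ^ K dvd poly p Phi2 - poly q Phi2"
    using Phi_polys_degree_reduce[OF assms(1) p(1)] by blast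
  have "2 ^ K dvd x - poly q Phi2" using dvd_add[OF p(2) q(3)] by simp
  then have "fls_cong x (poly q Phi2) (2 ^ K)" by (intro fls_cong_if_dvd) simp
  then show ?thesis using q unfolding laurent_coeffs_def by blast
qed

text \<open>The identity z S = u_2 - u_1 - 1 after substituting z = \<open>fls_X ^ 3\<close> and
  dividing by it; \<open>of_int 1\<close> matches the closure rule for
  \<open>Phi_approx\<close>.\<close>

lemma subgroup_gf_hecke5:
  "subgroup_gf (hecke_group 5) = fls_X_inv ^ 3 * (hecke5_fls 2 - hecke5_fls 1 - of_int 1)"
proof -
  have "fps_to_fls (hecke5_fps 2 - hecke5_fps 1 - 1) =
      fls_X * fps_to_fls (Abs_fps (\<lambda>n. int (subgroup_number (hecke_group 5) (n + 1))))"
    unfolding hecke5_fps_subgroup_number by (simp add: fls_times_fps_to_fls)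
  from arg_cong[OF this, of "\<lambda>f. fls_compose_power f 3"]
  have "hecke5_fls 2 - hecke5_fls 1 - 1 = fls_X ^ 3 * subgroup_gf (hecke_group 5)"
    by (simp add: hecke5_fls_def subgroup_gf_def fls_X_power_conv_shift_1)
  then have "fls_X_inv ^ 3 * (hecke5_fls 2 - hecke5_fls 1 - of_int 1) =
      fls_X_inv ^ 3 * fls_X ^ 3 * subgroup_gf (hecke_group 5)"
    by (simp add: mult.assoc)
  then show ?thesis by (simp only: X_inv_power_mult_X_power mult_1_left)
qed

theorem theorem36:
  fixes \<alpha> :: nat
  assumes "\<alpha> \<ge> 1"
  shows "\<exists>p :: int fls poly.
           degree p \<le> 4 ^ (\<alpha> + 1) - 1 \<and>
           (\<forall>i. laurent_polynomial (coeff p i)) \<and>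
           fls_cong (subgroup_gf (hecke_group 5)) (poly p Phi2) (2 ^ (4 ^ \<alpha>))"
proof -
  have K: "(4::nat) ^ \<alpha> \<ge> 1" by simp
  have "subgroup_gf (hecke_group 5) \<in> Phi_approx (4 ^ \<alpha>)"
    unfolding subgroup_gf_hecke5
    by (intro Phi_approx_mult Phi_approx_diff Phi_approx_X_inv_power Phi_approx_of_int hecke5_fls_in_Phi_approx K)
  from Phi_approx_poly[OF K this] obtain p where
    "degree p < 4 * 4 ^ \<alpha>" "\<forall>i. laurent_polynomial (coeff p i)"
    "fls_cong (subgroup_gf (hecke_group 5)) (poly p Phi2) (2 ^ (4 ^ \<alpha>))" by blast
  then show ?thesis by (intro exI[of _ p]) auto
qed

end
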